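(* Let $X$ be a connected separated monoid scheme and let $n\ge 1$. Then any vector bundle of rank $n$ over $X$ is isomorphic to a coproduct $\mathcal{L}_1\coprod\cdots\coprod\mathcal{L}_n$ of $n$ line bundles over $X$. Moreover, this decomposition is unique up to isomorphism of the summands and up to permuting the summands.
   Context: All monoids are commutative, multiplicative, with unit (no zero element is required). An ideal of a monoid $M$ is a (possibly empty) subset $I$ with $IM\subset I$; it is prime if $M\setminus I$ is a submonoid (so $\emptyset$ is prime). $\mathrm{Spec}(M)$ is the set of prime ideals with basis of open sets $D(f)=\{\mathfrak p : f\notin\mathfrak p\}$, $f\in M$, and sheaf of monoids $\mathcal{O}_M$ with $\mathcal{O}_M(D(f))=M_f$ (the localization inverting $f$). A monoid scheme is a topological space $X$ with a sheaf of monoids $\mathcal{O}_X$ that is locally isomorphic to some $(\mathrm{Spec}(M),\mathcal{O}_M)$ (affine monoid schemes); morphisms are local, as for usual schemes. Finite products exist, with $\mathrm{Spec}(M)\times\mathrm{Spec}(N)=\mathrm{Spec}(M\times N)$. $X$ is separated if the diagonal $X\to X\times X$ is a closed immersion; here $f:Z\to Y$ is a closed immersion if for every affine open $U=\mathrm{Spec}(M)\subset Y$ the preimage $f^{-1}(U)$ is affine, $f^{-1}(U)=\mathrm{Spec}(N)$, and $M\to N$ is surjective. (In particular the intersection of two affine open subschemes of a separated monoid scheme is affine.) For a monoid $M$, $M^{\coprod n}$ denotes the free $M$-set of rank $n$, i.e. the disjoint union of $n$ copies of $M$. A vector bundle of rank $n$ on $X$ is a sheaf of sets $\mathcal V$ on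 $X$ with an action of $\mathcal{O}_X$ which is locally isomorphic to $\mathcal{O}_X^{\coprod n}$. A line bundle is a vector bundle of rank $1$. The coproduct of vector bundles is induced by disjoint union of $M$-sets (followed by sheafification). *)

theory Defs
  imports "HOL-Analysis.Analysis" "HOL-Algebra.Group"
begin

section \<open>Presheaves and sheaves of sets\<close>

text \<open>
  A presheaf of sets on a topological space \<open>T\<close> is given by its sets of sections \<open>F U\<close> and
  restriction maps \<open>r U V\<close> from \<open>F U\<close> to \<open>F V\<close>. Values of \<open>F\<close> and \<open>r\<close> at sets that are not open,
  and of \<open>r U V\<close> outside \<open>F U\<close>, are irrelevant.
\<close>

locale set_presheaf =
  fixes T :: "'p topology" and F :: "'p set \<Rightarrow> 't set" and r :: "'p set \<Rightarrow> 'p set \<Rightarrow> 't \<Rightarrow> 't"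
  assumes restr_closed: "\<lbrakk>openin T U; openin T V; V \<subseteq> U; s \<in> F U\<rbrakk> \<Longrightarrow> r U V s \<in> F V"
    and restr_id: "\<lbrakk>openin T U; s \<in> F U\<rbrakk> \<Longrightarrow> r U U s = s"
    and restr_restr: "\<lbrakk>openin T U; openin T V; openin T W; W \<subseteq> V; V \<subseteq> U; s \<in> F U\<rbrakk>
          \<Longrightarrow> r V W (r U V s) = r U W s"

text \<open>
  Families of local sections may be indexed by the open sets of the covering themselves, because
  compatibility forces two sections over the same open set to be equal.
\<close>

locale set_sheaf = set_presheaf +
  assumes glue: "\<lbrakk>\<And>U. U \<in> \<U> \<Longrightarrow> openin T U; \<And>U. U \<in> \<U> \<Longrightarrow> \<sigma> U \<in> F U;
            \<And>U V. \<lbrakk>U \<in> \<U>; V \<in> \<U>\<rbrakk> \<Longrightarrow> r U (U \<inter> V) (\<sigma> U) = r V (U \<inter> V) (\<sigma> V)\<rbrakk>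
          \<Longrightarrow> \<exists>!s. s \<in> F (\<Union>\<U>) \<and> (\<forall>U\<in>\<U>. r (\<Union>\<U>) U s = \<sigma> U)"

definition germ ::
  "'p topology \<Rightarrow> ('p set \<Rightarrow> 't set) \<Rightarrow> ('p set \<Rightarrow> 'p set \<Rightarrow> 't \<Rightarrow> 't) \<Rightarrow> 'p \<Rightarrow> 'p set \<Rightarrow> 't
     \<Rightarrow> ('p set \<times> 't) set"
  where "germ T F r x U s =
    {(V, t). openin T V \<and> x \<in> V \<and> t \<in> F V \<and>
             (\<exists>W. openin T W \<and> x \<in> W \<and> W \<subseteq> U \<inter> V \<and> r U W s = r V W t)}"

definition stalk ::
  "'p topology \<Rightarrow> ('p set \<Rightarrow> 't set) \<Rightarrow> ('p set \<Rightarrow> 'p set \<Rightarrow> 't \<Rightarrow> 't) \<Rightarrow> 'p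
     \<Rightarrow> ('p set \<times> 't) set set"
  where "stalk T F r x = {germ T F r x U s | U s. openin T U \<and> x \<in> U \<and> s \<in> F U}"

definition sheafify_sections ::
  "'p topology \<Rightarrow> ('p set \<Rightarrow> 't set) \<Rightarrow> ('p set \<Rightarrow> 'p set \<Rightarrow> 't \<Rightarrow> 't) \<Rightarrow> 'p set
     \<Rightarrow> ('p \<Rightarrow> ('p set \<times> 't) set) set"
  where "sheafify_sections T F r U =
    {\<sigma> \<in> extensional U. \<forall>x\<in>U. \<exists>V s. openin T V \<and> x \<in> V \<and> V \<subseteq> U \<and> s \<in> F V \<and>
                              (\<forall>y\<in>V. \<sigma> y = germ T F r y V s)}"


section \<open>Spaces with a sheaf of commutative monoids\<close>

record ('p, 's) monoidal_space =
  mtop :: "'p topology"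
  sec :: "'p set \<Rightarrow> 's monoid"
  res :: "'p set \<Rightarrow> 'p set \<Rightarrow> 's \<Rightarrow> 's"

definition monoid_hom :: "'a monoid \<Rightarrow> 'b monoid \<Rightarrow> ('a \<Rightarrow> 'b) set"
  where "monoid_hom M N = {h \<in> hom M N. h \<one>\<^bsub>M\<^esub> = \<one>\<^bsub>N\<^esub>}"

definition is_monoidal_space :: "('p, 's) monoidal_space \<Rightarrow> bool"
  where "is_monoidal_space X \<longleftrightarrow>
    set_sheaf (mtop X) (\<lambda>U. carrier (sec X U)) (res X) \<and>
    (\<forall>U. openin (mtop X) U \<longrightarrow> comm_monoid (sec X U)) \<and>
    (\<forall>U V. openin (mtop X) U \<and> openin (mtop X) V \<and> V \<subseteq> U
       \<longrightarrow> res X U V \<in> monoid_hom (sec X U) (sec X V))"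

definition open_subspace :: "('p, 's) monoidal_space \<Rightarrow> 'p set \<Rightarrow> ('p, 's) monoidal_space"
  where "open_subspace X U = X\<lparr>mtop := subtopology (mtop X) U\<rparr>"

abbreviation sgerm :: "('p, 's) monoidal_space \<Rightarrow> 'p \<Rightarrow> 'p set \<Rightarrow> 's \<Rightarrow> ('p set \<times> 's) set"
  where "sgerm X \<equiv> germ (mtop X) (\<lambda>U. carrier (sec X U)) (res X)"

text \<open>
  All members of the union below are the same germ, since the product of two germs does not depend
  on their representatives; the same device is used for the other operations on classes.
\<close>

definition stalk_monoid :: "('p, 's) monoidal_space \<Rightarrow> 'p \<Rightarrow> ('p set \<times> 's) set monoid"
  where "stalk_monoid X x =
    \<lparr>carrier = stalk (mtop X) (\<lambda>U. carrier (sec X U)) (res X) x,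
     mult = (\<lambda>g h. \<Union>(U, s)\<in>g. \<Union>(V, t)\<in>h.
               sgerm X x (U \<inter> V) (res X U (U \<inter> V) s \<otimes>\<^bsub>sec X (U \<inter> V)\<^esub> res X V (U \<inter> V) t)),
     one = sgerm X x (topspace (mtop X)) \<one>\<^bsub>sec X (topspace (mtop X))\<^esub>\<rparr>"

text \<open>
  A map from \<open>X\<close> to \<open>Y\<close> is a function \<open>f\<close> on points together with maps \<open>f\<^sup># V\<close> from sections of
  \<open>Y\<close> over \<open>V\<close> to sections of \<open>X\<close> over the preimage of \<open>V\<close>.
\<close>

type_synonym ('p, 's, 'q, 't) space_map = "('p \<Rightarrow> 'q) \<times> ('q set \<Rightarrow> 't \<Rightarrow> 's)"

definition preim :: "('p, 's) monoidal_space \<Rightarrow> ('p, 's, 'q, 't) space_map \<Rightarrow> 'q set \<Rightarrow> 'p set"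
  where "preim X f V = {x \<in> topspace (mtop X). fst f x \<in> V}"

definition monoidal_morphism ::
  "('p, 's) monoidal_space \<Rightarrow> ('q, 't) monoidal_space \<Rightarrow> ('p, 's, 'q, 't) space_map \<Rightarrow> bool"
  where "monoidal_morphism X Y f \<longleftrightarrow>
    continuous_map (mtop X) (mtop Y) (fst f) \<and>
    (\<forall>V. openin (mtop Y) V \<longrightarrow> snd f V \<in> monoid_hom (sec Y V) (sec X (preim X f V))) \<and>
    (\<forall>V W s. openin (mtop Y) V \<and> openin (mtop Y) W \<and> W \<subseteq> V \<and> s \<in> carrier (sec Y V)
       \<longrightarrow> snd f W (res Y V W s) = res X (preim X f V) (preim X f W) (snd f V s))"

text \<open>
  The last clause says that the induced homomorphisms of stalks are local: they reflect units.
\<close>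

definition local_morphism ::
  "('p, 's) monoidal_space \<Rightarrow> ('q, 't) monoidal_space \<Rightarrow> ('p, 's, 'q, 't) space_map \<Rightarrow> bool"
  where "local_morphism X Y f \<longleftrightarrow>
    monoidal_morphism X Y f \<and>
    (\<forall>x\<in>topspace (mtop X). \<forall>V s.
       openin (mtop Y) V \<and> fst f x \<in> V \<and> s \<in> carrier (sec Y V) \<and>
       sgerm X x (preim X f V) (snd f V s) \<in> Units (stalk_monoid X x)
       \<longrightarrow> sgerm Y (fst f x) V s \<in> Units (stalk_monoid Y (fst f x)))"

definition map_comp ::
  "('q, 't) monoidal_space \<Rightarrow> ('q, 't, 'z, 'u) space_map \<Rightarrow> ('p, 's, 'q, 't) space_map
     \<Rightarrow> ('p, 's, 'z, 'u) space_map"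
  where "map_comp Y g f = (fst g \<circ> fst f, \<lambda>W. snd f (preim Y g W) \<circ> snd g W)"

definition map_id :: "('p, 's, 'p, 's) space_map"
  where "map_id = (id, \<lambda>U. id)"

definition map_eq ::
  "('p, 's) monoidal_space \<Rightarrow> ('q, 't) monoidal_space
     \<Rightarrow> ('p, 's, 'q, 't) space_map \<Rightarrow> ('p, 's, 'q, 't) space_map \<Rightarrow> bool"
  where "map_eq X Y f g \<longleftrightarrow>
    (\<forall>x\<in>topspace (mtop X). fst f x = fst g x) \<and>
    (\<forall>V. openin (mtop Y) V \<longrightarrow> (\<forall>s\<in>carrier (sec Y V). snd f V s = snd g V s))"

definition space_iso ::
  "('p, 's) monoidal_space \<Rightarrow> ('q, 't) monoidal_space \<Rightarrow> ('p, 's, 'q, 't) space_map \<Rightarrow> bool"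
  where "space_iso X Y f \<longleftrightarrow>
    monoidal_morphism X Y f \<and>
    homeomorphic_map (mtop X) (mtop Y) (fst f) \<and>
    (\<forall>V. openin (mtop Y) V \<longrightarrow>
       bij_betw (snd f V) (carrier (sec Y V)) (carrier (sec X (preim X f V))))"


section \<open>The spectrum of a monoid\<close>

definition mon_ideal :: "'a monoid \<Rightarrow> 'a set \<Rightarrow> bool"
  where "mon_ideal M I \<longleftrightarrow> I \<subseteq> carrier M \<and> (\<forall>a\<in>I. \<forall>b\<in>carrier M. a \<otimes>\<^bsub>M\<^esub> b \<in> I)"

definition mon_prime :: "'a monoid \<Rightarrow> 'a set \<Rightarrow> bool"
  where "mon_prime M P \<longleftrightarrow> mon_ideal M P \<and> submonoid (carrier M - P) M"

definition basic_open :: "'a monoid \<Rightarrow> 'a \<Rightarrow> 'a set set"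
  where "basic_open M f = {P. mon_prime M P \<and> f \<notin> P}"

definition Spec_top :: "'a monoid \<Rightarrow> 'a set topology"
  where "Spec_top M = topology (arbitrary union_of (\<lambda>U. \<exists>f\<in>carrier M. U = basic_open M f))"

definition fraction :: "'a monoid \<Rightarrow> 'a set \<Rightarrow> 'a \<Rightarrow> 'a \<Rightarrow> ('a \<times> 'a) set"
  where "fraction M S a s =
    {(b, t) \<in> carrier M \<times> S. \<exists>u\<in>S. u \<otimes>\<^bsub>M\<^esub> (t \<otimes>\<^bsub>M\<^esub> a) = u \<otimes>\<^bsub>M\<^esub> (s \<otimes>\<^bsub>M\<^esub> b)}"

definition localization :: "'a monoid \<Rightarrow> 'a set \<Rightarrow> ('a \<times> 'a) set monoid"
  where "localization M S =
    \<lparr>carrier = {fraction M S a s | a s. a \<in> carrier M \<and> s \<in> S},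
     mult = (\<lambda>x y. \<Union>(a, s)\<in>x. \<Union>(b, t)\<in>y. fraction M S (a \<otimes>\<^bsub>M\<^esub> b) (s \<otimes>\<^bsub>M\<^esub> t)),
     one = fraction M S \<one>\<^bsub>M\<^esub> \<one>\<^bsub>M\<^esub>\<rparr>"

text \<open>
  As for rings, sections over \<open>U\<close> are the families of elements of the localizations at the primes
  in \<open>U\<close> that are locally given by one fraction. This is the sheaf whose monoid of sections over
  \<open>basic_open M f\<close> is the localization of \<open>M\<close> inverting \<open>f\<close>.
\<close>

definition Spec_sections :: "'a monoid \<Rightarrow> 'a set set \<Rightarrow> ('a set \<Rightarrow> ('a \<times> 'a) set) set"
  where "Spec_sections M U =
    {\<sigma> \<in> extensional U. \<forall>P\<in>U. \<exists>V. openin (Spec_top M) V \<and> P \<in> V \<and> V \<subseteq> U \<and>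
       (\<exists>a\<in>carrier M. \<exists>f\<in>carrier M. \<forall>Q\<in>V. f \<notin> Q \<and> \<sigma> Q = fraction M (carrier M - Q) a f)}"

definition Spec :: "'a monoid \<Rightarrow> ('a set, 'a set \<Rightarrow> ('a \<times> 'a) set) monoidal_space"
  where "Spec M =
    \<lparr>mtop = Spec_top M,
     sec = (\<lambda>U. \<lparr>carrier = Spec_sections M U,
                 mult = (\<lambda>\<sigma> \<tau>. \<lambda>P\<in>U. \<sigma> P \<otimes>\<^bsub>localization M (carrier M - P)\<^esub> \<tau> P),
                 one = (\<lambda>P\<in>U. \<one>\<^bsub>localization M (carrier M - P)\<^esub>)\<rparr>),
     res = (\<lambda>U V \<sigma>. restrict \<sigma> V)\<rparr>"


section \<open>Monoid schemes\<close>

text \<open>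
  It is no restriction to take \<open>M\<close> over the type of sections of \<open>X\<close>: if \<open>X\<close> is isomorphic to
  \<open>Spec N\<close>, then \<open>N\<close> is isomorphic to the monoid of global sections of \<open>X\<close>.
\<close>

definition affine_mscheme :: "('p, 's) monoidal_space \<Rightarrow> bool"
  where "affine_mscheme X \<longleftrightarrow>
    is_monoidal_space X \<and> (\<exists>(M :: 's monoid) f. comm_monoid M \<and> space_iso X (Spec M) f)"

definition mscheme :: "('p, 's) monoidal_space \<Rightarrow> bool"
  where "mscheme X \<longleftrightarrow>
    is_monoidal_space X \<and>
    (\<forall>x\<in>topspace (mtop X). \<exists>U. openin (mtop X) U \<and> x \<in> U \<and> affine_mscheme (open_subspace X U))"

definition affine_open :: "('p, 's) monoidal_space \<Rightarrow> 'p set \<Rightarrow> bool"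
  where "affine_open X U \<longleftrightarrow> openin (mtop X) U \<and> affine_mscheme (open_subspace X U)"

definition closed_immersion ::
  "('p, 's) monoidal_space \<Rightarrow> ('q, 't) monoidal_space \<Rightarrow> ('p, 's, 'q, 't) space_map \<Rightarrow> bool"
  where "closed_immersion Z Y f \<longleftrightarrow>
    local_morphism Z Y f \<and>
    (\<forall>U. affine_open Y U \<longrightarrow>
       affine_open Z (preim Z f U) \<and>
       snd f U ` carrier (sec Y U) = carrier (sec Z (preim Z f U)))"

text \<open>
  The product of monoid schemes. For monoids \<open>M\<close> and \<open>N\<close> the prime ideals of \<open>M \<times>\<times> N\<close> correspond
  to pairs of prime ideals, and localizations of \<open>M \<times>\<times> N\<close> at primes are products of localizations;
  so, unlike for rings, the underlying space of the product is the product space and its stalks are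
  the products of the stalks. With the projections below this is the categorical product, and
  \<open>prod_space (Spec M) (Spec N)\<close> is isomorphic to \<open>Spec (M \<times>\<times> N)\<close>.
\<close>

definition prod_sections ::
  "('p, 's) monoidal_space \<Rightarrow> ('q, 't) monoidal_space \<Rightarrow> ('p \<times> 'q) set
     \<Rightarrow> ('p \<times> 'q \<Rightarrow> ('p set \<times> 's) set \<times> ('q set \<times> 't) set) set"
  where "prod_sections X Y W =
    {\<sigma> \<in> extensional W. \<forall>(x, y)\<in>W. \<exists>U V a b.
       openin (mtop X) U \<and> openin (mtop Y) V \<and> x \<in> U \<and> y \<in> V \<and> U \<times> V \<subseteq> W \<and>
       a \<in> carrier (sec X U) \<and> b \<in> carrier (sec Y V) \<and>
       (\<forall>x'\<in>U. \<forall>y'\<in>V. \<sigma> (x', y') = (sgerm X x' U a, sgerm Y y' V b))}"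

definition prod_space ::
  "('p, 's) monoidal_space \<Rightarrow> ('q, 't) monoidal_space
     \<Rightarrow> ('p \<times> 'q, 'p \<times> 'q \<Rightarrow> ('p set \<times> 's) set \<times> ('q set \<times> 't) set) monoidal_space"
  where "prod_space X Y =
    \<lparr>mtop = prod_topology (mtop X) (mtop Y),
     sec = (\<lambda>W. \<lparr>carrier = prod_sections X Y W,
                 mult = (\<lambda>\<sigma> \<tau>. \<lambda>z\<in>W. \<sigma> z \<otimes>\<^bsub>stalk_monoid X (fst z) \<times>\<times> stalk_monoid Y (snd z)\<^esub> \<tau> z),
                 one = (\<lambda>z\<in>W. \<one>\<^bsub>stalk_monoid X (fst z) \<times>\<times> stalk_monoid Y (snd z)\<^esub>)\<rparr>),
     res = (\<lambda>W W' \<sigma>. restrict \<sigma> W')\<rparr>"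

definition prod_fst ::
  "('p, 's) monoidal_space \<Rightarrow> ('q, 't) monoidal_space
     \<Rightarrow> ('p \<times> 'q, 'p \<times> 'q \<Rightarrow> ('p set \<times> 's) set \<times> ('q set \<times> 't) set, 'p, 's) space_map"
  where "prod_fst X Y =
    (fst, \<lambda>U a. \<lambda>z\<in>U \<times> topspace (mtop Y). (sgerm X (fst z) U a, \<one>\<^bsub>stalk_monoid Y (snd z)\<^esub>))"

definition prod_snd ::
  "('p, 's) monoidal_space \<Rightarrow> ('q, 't) monoidal_space
     \<Rightarrow> ('p \<times> 'q, 'p \<times> 'q \<Rightarrow> ('p set \<times> 's) set \<times> ('q set \<times> 't) set, 'q, 't) space_map"
  where "prod_snd X Y =
    (snd, \<lambda>V b. \<lambda>z\<in>topspace (mtop X) \<times> V. (\<one>\<^bsub>stalk_monoid X (fst z)\<^esub>, sgerm Y (snd z) V b))"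

definition is_diagonal ::
  "('p, 's) monoidal_space
     \<Rightarrow> ('p, 's, 'p \<times> 'p, 'p \<times> 'p \<Rightarrow> ('p set \<times> 's) set \<times> ('p set \<times> 's) set) space_map \<Rightarrow> bool"
  where "is_diagonal X d \<longleftrightarrow>
    local_morphism X (prod_space X X) d \<and>
    map_eq X X (map_comp (prod_space X X) (prod_fst X X) d) map_id \<and>
    map_eq X X (map_comp (prod_space X X) (prod_snd X X) d) map_id"

definition separated :: "('p, 's) monoidal_space \<Rightarrow> bool"
  where "separated X \<longleftrightarrow> (\<exists>d. is_diagonal X d \<and> closed_immersion X (prod_space X X) d)"


section \<open>Vector bundles\<close>

record ('p, 's, 't) oset =
  osec :: "'p set \<Rightarrow> 't set"
  ores :: "'p set \<Rightarrow> 'p set \<Rightarrow> 't \<Rightarrow> 't"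
  oact :: "'p set \<Rightarrow> 's \<Rightarrow> 't \<Rightarrow> 't"

definition oset_sheaf :: "('p, 's) monoidal_space \<Rightarrow> ('p, 's, 't) oset \<Rightarrow> bool"
  where "oset_sheaf X F \<longleftrightarrow>
    set_sheaf (mtop X) (osec F) (ores F) \<and>
    (\<forall>U. openin (mtop X) U \<longrightarrow>
       (\<forall>a\<in>carrier (sec X U). \<forall>v\<in>osec F U. oact F U a v \<in> osec F U) \<and>
       (\<forall>v\<in>osec F U. oact F U \<one>\<^bsub>sec X U\<^esub> v = v) \<and>
       (\<forall>a\<in>carrier (sec X U). \<forall>b\<in>carrier (sec X U). \<forall>v\<in>osec F U.
          oact F U (a \<otimes>\<^bsub>sec X U\<^esub> b) v = oact F U a (oact F U b v))) \<and>
    (\<forall>U V. openin (mtop X) U \<and> openin (mtop X) V \<and> V \<subseteq> U \<longrightarrow>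
       (\<forall>a\<in>carrier (sec X U). \<forall>v\<in>osec F U.
          ores F U V (oact F U a v) = oact F V (res X U V a) (ores F U V v)))"

definition oset_iso ::
  "('p, 's) monoidal_space \<Rightarrow> ('p, 's, 't) oset \<Rightarrow> ('p, 's, 'u) oset \<Rightarrow> ('p set \<Rightarrow> 't \<Rightarrow> 'u) \<Rightarrow> bool"
  where "oset_iso X F G \<eta> \<longleftrightarrow>
    (\<forall>U. openin (mtop X) U \<longrightarrow>
       bij_betw (\<eta> U) (osec F U) (osec G U) \<and>
       (\<forall>a\<in>carrier (sec X U). \<forall>v\<in>osec F U. \<eta> U (oact F U a v) = oact G U a (\<eta> U v))) \<and>
    (\<forall>U V. openin (mtop X) U \<and> openin (mtop X) V \<and> V \<subseteq> U \<longrightarrow>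
       (\<forall>v\<in>osec F U. \<eta> V (ores F U V v) = ores G U V (\<eta> U v)))"

definition oset_isomorphic ::
  "('p, 's) monoidal_space \<Rightarrow> ('p, 's, 't) oset \<Rightarrow> ('p, 's, 'u) oset \<Rightarrow> bool"
  where "oset_isomorphic X F G \<longleftrightarrow> (\<exists>\<eta>. oset_iso X F G \<eta>)"

definition oset_sheafify ::
  "('p, 's) monoidal_space \<Rightarrow> ('p, 's, 't) oset \<Rightarrow> ('p, 's, 'p \<Rightarrow> ('p set \<times> 't) set) oset"
  where "oset_sheafify X F =
    \<lparr>osec = sheafify_sections (mtop X) (osec F) (ores F),
     ores = (\<lambda>U V \<sigma>. restrict \<sigma> V),
     oact = (\<lambda>U a \<sigma>. \<lambda>x\<in>U. \<Union>(V, v)\<in>\<sigma> x.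
               germ (mtop X) (osec F) (ores F) x (U \<inter> V)
                 (oact F (U \<inter> V) (res X U (U \<inter> V) a) (ores F V (U \<inter> V) v)))\<rparr>"

definition presheaf_coprod :: "nat \<Rightarrow> (nat \<Rightarrow> ('p, 's, 't) oset) \<Rightarrow> ('p, 's, nat \<times> 't) oset"
  where "presheaf_coprod n F =
    \<lparr>osec = (\<lambda>U. SIGMA i:{..<n}. osec (F i) U),
     ores = (\<lambda>U V (i, v). (i, ores (F i) U V v)),
     oact = (\<lambda>U a (i, v). (i, oact (F i) U a v))\<rparr>"

definition oset_coprod ::
  "('p, 's) monoidal_space \<Rightarrow> nat \<Rightarrow> (nat \<Rightarrow> ('p, 's, 't) oset)
     \<Rightarrow> ('p, 's, 'p \<Rightarrow> ('p set \<times> nat \<times> 't) set) oset"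
  where "oset_coprod X n F = oset_sheafify X (presheaf_coprod n F)"

definition structure_oset :: "('p, 's) monoidal_space \<Rightarrow> ('p, 's, 's) oset"
  where "structure_oset X =
    \<lparr>osec = (\<lambda>U. carrier (sec X U)), ores = res X, oact = (\<lambda>U a b. a \<otimes>\<^bsub>sec X U\<^esub> b)\<rparr>"

definition free_oset ::
  "('p, 's) monoidal_space \<Rightarrow> nat \<Rightarrow> ('p, 's, 'p \<Rightarrow> ('p set \<times> nat \<times> 's) set) oset"
  where "free_oset X n = oset_coprod X n (\<lambda>i. structure_oset X)"

text \<open>
  The restriction of a sheaf \<open>F\<close> to an open subset \<open>U\<close> is \<open>F\<close> itself viewed over
  \<open>open_subspace X U\<close>, where only the open sets contained in \<open>U\<close> matter.
\<close>

definition vector_bundle :: "('p, 's) monoidal_space \<Rightarrow> nat \<Rightarrow> ('p, 's, 't) oset \<Rightarrow> bool"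
  where "vector_bundle X n F \<longleftrightarrow>
    oset_sheaf X F \<and>
    (\<forall>x\<in>topspace (mtop X). \<exists>U. openin (mtop X) U \<and> x \<in> U \<and>
       oset_isomorphic (open_subspace X U) F (free_oset X n))"

abbreviation line_bundle :: "('p, 's) monoidal_space \<Rightarrow> ('p, 's, 't) oset \<Rightarrow> bool"
  where "line_bundle X \<equiv> vector_bundle X 1"

end

theory Submission
  imports Defs
begin

text \<open>
  The spectrum of a monoid is irreducible, because the empty prime lies in every nonempty open
  set. A connected space covered by irreducible open sets is irreducible, so any two nonempty open
  subsets of \<open>X\<close> meet. Over a monoid the indecomposable components of a free set of rank \<open>n\<close> are its
  \<open>n\<close> cyclic summands, so on a trivializing open set every section has an index in \<open>{..<n}\<close>, which
  neither restriction nor the action changes. By irreducibility an index chosen over one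
  trivializing open set extends to all sections of the bundle; the sections of index \<open>i\<close> form the
  line bundle \<open>L i\<close>. An isomorphism of coproducts of line bundles maps components to components by
  one permutation, again because any two nonempty open sets meet.
\<close>

section \<open>Irreducible spaces\<close>

text \<open>The obstacle is sheafification: sections of a coproduct are families of germs, and an
  isomorphism between such objects does not visibly respect the summands. On an irreducible space
  the presheaf coproduct already has the right sections over every nonempty open set, so after one
  comparison all arguments deal with pairs of an index and a section. It remains to see which
  property of a summand forces an isomorphism to send it into a single component. A generator over
  just one nonempty open set suffices: action and restriction keep the index, and every nonempty
  open set meets the one that carries the generator. Existence and uniqueness both rest on this.
  Uniqueness compares two decompositions; existence compares an arbitrary trivialization with the
  splitting read off from a fixed one. The empty space counts as irreducible here and is treated
  separately in both halves.\<close>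

definition irreducible_top :: "'p topology \<Rightarrow> bool"
  where "irreducible_top T \<longleftrightarrow>
    (\<forall>A B. openin T A \<and> openin T B \<and> A \<noteq> {} \<and> B \<noteq> {} \<longrightarrow> A \<inter> B \<noteq> {})"

lemma irreducible_topD:
  "\<lbrakk>irreducible_top T; openin T A; openin T B; A \<noteq> {}; B \<noteq> {}\<rbrakk> \<Longrightarrow> A \<inter> B \<noteq> {}"
  unfolding irreducible_top_def by blast

lemma irreducible_top_homeomorphic_map:
  assumes f: "homeomorphic_map S T f" and T: "irreducible_top T"
  shows "irreducible_top S"
  unfolding irreducible_top_def
proof (intro allI impI, elim conjE)
  fix A B assume A: "openin S A" "A \<noteq> {}" and B: "openin S B" "B \<noteq> {}"
  have sub: "A \<subseteq> topspace S" "B \<subseteq> topspace S" using A B openin_subset by blast+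
  have "openin T (f ` A)" "openin T (f ` B)"
    using homeomorphic_map_openness[OF f] sub A B by blast+
  then have "f ` A \<inter> f ` B \<noteq> {}" using irreducible_topD[OF T] A B by blast
  moreover have "inj_on f (topspace S)" using f homeomorphic_imp_injective_map by blast
  ultimately show "A \<inter> B \<noteq> {}" using sub by (auto dest: inj_onD)
qed

text \<open>For a nonempty open \<open>A\<close>, the irreducible members of the cover that meet
  \<open>A\<close> and those that miss it have disjoint unions: if \<open>U\<close> meets both
  \<open>A\<close> and some \<open>V\<close>, irreducibility of \<open>U\<close> makes
  \<open>A\<close> and \<open>V\<close> meet. Connectedness leaves only the first union, so a second
  nonempty open set \<open>B\<close> meets some \<open>U\<close> that \<open>A\<close> meets
  too.\<close>

lemma irreducible_top_of_connected:
  assumes conn: "connected_space T"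
    and loc: "\<And>x. x \<in> topspace T
               \<Longrightarrow> \<exists>U. openin T U \<and> x \<in> U \<and> irreducible_top (subtopology T U)"
  shows "irreducible_top T"
  unfolding irreducible_top_def
proof (intro allI impI, elim conjE)
  fix A B assume A: "openin T A" "A \<noteq> {}" and B: "openin T B" "B \<noteq> {}"
  define \<I> where "\<I> = {U. openin T U \<and> irreducible_top (subtopology T U)}"
  have meet: "P \<inter> Q \<inter> U \<noteq> {}"
    if "U \<in> \<I>" "openin T P" "openin T Q" "P \<inter> U \<noteq> {}" "Q \<inter> U \<noteq> {}" for P Q U
  proof -
    have "openin (subtopology T U) (P \<inter> U)" "openin (subtopology T U) (Q \<inter> U)"
      using that openin_subtopology_Int by blast+
    then have "(P \<inter> U) \<inter> (Q \<inter> U) \<noteq> {}"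
      using irreducible_topD[of "subtopology T U" "P \<inter> U" "Q \<inter> U"] that(1,4,5)
      unfolding \<I>_def by simp
    then show ?thesis by blast
  qed
  define C where "C = \<Union>{U \<in> \<I>. A \<inter> U \<noteq> {}}"
  define D where "D = \<Union>{U \<in> \<I>. A \<inter> U = {}}"
  have op: "openin T C" "openin T D" unfolding C_def D_def \<I>_def by auto
  have cover: "topspace T \<subseteq> C \<union> D"
  proof
    fix x assume "x \<in> topspace T"
    then obtain U where "U \<in> \<I>" "x \<in> U" using loc unfolding \<I>_def by blast
    then show "x \<in> C \<union> D" unfolding C_def D_def by blast
  qed
  have disj: "C \<inter> D = {}"
  proof (rule ccontr)
    assume "C \<inter> D \<noteq> {}"
    then obtain U V where "U \<in> \<I>" "V \<in> \<I>" "A \<inter> U \<noteq> {}" "A \<inter> V = {}" "V \<inter> U \<noteq> {}"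
      unfolding C_def D_def by blast
    moreover have "openin T V" using \<open>V \<in> \<I>\<close> unfolding \<I>_def by blast
    ultimately show False using meet[of U A V] A by blast
  qed
  have "A \<subseteq> C"
  proof
    fix a assume a: "a \<in> A"
    then obtain U where "U \<in> \<I>" "a \<in> U"
      using loc openin_subset[OF A(1)] unfolding \<I>_def by blast
    then show "a \<in> C" using a unfolding C_def by blast
  qed
  then have "C \<noteq> {}" using A by blast
  then have "D = {}"
    using conn op cover disj unfolding connected_space_def by metis
  then have "B \<inter> C \<noteq> {}" using B cover openin_subset[OF B(1)] by auto
  then obtain U where "U \<in> \<I>" "A \<inter> U \<noteq> {}" "B \<inter> U \<noteq> {}" unfolding C_def by blast
  then show "A \<inter> B \<noteq> {}" using meet[of U A B] A B by blast
qed

section \<open>The topology of a monoid spectrum\<close>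

lemma openin_Spec_top:
  assumes M: "comm_monoid M"
  shows "openin (Spec_top M) =
    arbitrary union_of (\<lambda>U. \<exists>f\<in>carrier M. U = basic_open M f)"
proof -
  interpret comm_monoid M by (rule M)
  \<comment> \<open>A prime omits a product exactly when it omits both factors. Hence the basic open
    sets are closed under intersection and their unions form a topology, which has to be known
    before \<open>openin\<close> can be computed from \<open>topology\<close>.\<close>
  have "basic_open M f \<inter> basic_open M g = basic_open M (f \<otimes>\<^bsub>M\<^esub> g)"
    if fg: "f \<in> carrier M" "g \<in> carrier M" for f g
  proof -
    have "f \<otimes>\<^bsub>M\<^esub> g \<notin> P \<longleftrightarrow> f \<notin> P \<and> g \<notin> P" if "mon_prime M P" for P
    proof -
      from that have I: "mon_ideal M P" and S: "submonoid (carrier M - P) M"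
        unfolding mon_prime_def by auto
      have "f \<otimes>\<^bsub>M\<^esub> g \<in> P" if "f \<in> P \<or> g \<in> P"
        using that I fg m_comm[OF fg] unfolding mon_ideal_def by metis
      moreover have "f \<otimes>\<^bsub>M\<^esub> g \<notin> P" if "f \<notin> P" "g \<notin> P"
        using submonoid.m_closed[OF S, of f g] that fg by blast
      ultimately show ?thesis by blast
    qed
    then show ?thesis unfolding basic_open_def by blast
  qed
  then have "\<exists>h\<in>carrier M. U \<inter> V = basic_open M h"
    if "\<exists>f\<in>carrier M. U = basic_open M f" "\<exists>f\<in>carrier M. V = basic_open M f" for U V
    using that m_closed by blast
  then have "istopology (arbitrary union_of (\<lambda>U. \<exists>f\<in>carrier M. U = basic_open M f))"
    by (rule istopology_base)
  then show ?thesis unfolding Spec_top_def by (rule topology_inverse')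
qed

lemma empty_mem_openin_Spec_top:
  assumes M: "comm_monoid M" and U: "openin (Spec_top M) U" "U \<noteq> {}"
  shows "{} \<in> U"
proof -
  interpret comm_monoid M by (rule M)
  have "mon_prime M {}"
    unfolding mon_prime_def mon_ideal_def by (auto intro!: submonoid.intro)
  then show ?thesis
    using U unfolding openin_Spec_top[OF M] union_of_def basic_open_def by blast
qed

lemma irreducible_top_Spec_top:
  "comm_monoid M \<Longrightarrow> irreducible_top (Spec_top M)"
  unfolding irreducible_top_def using empty_mem_openin_Spec_top by blast

lemma irreducible_top_connected_mscheme:
  assumes "mscheme X" "connected_space (mtop X)"
  shows "irreducible_top (mtop X)"
proof (rule irreducible_top_of_connected[OF assms(2)])
  fix x assume "x \<in> topspace (mtop X)"
  then obtain U where U: "openin (mtop X) U" "x \<in> U" "affine_mscheme (open_subspace X U)"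
    using assms(1) unfolding mscheme_def by blast
  then obtain M :: "'b monoid" and f
    where "comm_monoid M" and "space_iso (open_subspace X U) (Spec M) f"
    unfolding affine_mscheme_def by blast
  then have "homeomorphic_map (subtopology (mtop X) U) (Spec_top M) (fst f)"
    unfolding space_iso_def open_subspace_def Spec_def by simp
  then have "irreducible_top (subtopology (mtop X) U)"
    using irreducible_top_homeomorphic_map irreducible_top_Spec_top[OF \<open>comm_monoid M\<close>] by blast
  then show "\<exists>U. openin (mtop X) U \<and> x \<in> U \<and> irreducible_top (subtopology (mtop X) U)"
    using U by blast
qed


section \<open>Germs and sheafified coproducts\<close>

text \<open>Where \<open>s\<close> agrees with \<open>t\<close> and \<open>t\<close> agrees with
  another representative, \<open>s\<close> agrees with that representative, so intersecting the two
  neighbourhoods is enough. The reverse inclusion comes from exchanging \<open>s\<close> and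
  \<open>t\<close>.\<close>

lemma (in set_presheaf) germ_subset:
  assumes U: "openin T U" "s \<in> F U" and V: "openin T V" "t \<in> F V"
    and W: "openin T W" "x \<in> W" "W \<subseteq> U \<inter> V" "r U W s = r V W t"
  shows "germ T F r x V t \<subseteq> germ T F r x U s"
proof (clarsimp simp: germ_def)
  fix Z z W' assume Z: "openin T Z" "x \<in> Z" "z \<in> F Z"
    and W': "openin T W'" "x \<in> W'" "W' \<subseteq> V" "W' \<subseteq> Z" "r V W' t = r Z W' z"
  let ?I = "W \<inter> W'"
  have I: "openin T ?I" using W W' by blast
  have "r U ?I s = r W ?I (r U W s)" using U W I restr_restr[of U W ?I s] by simp
  also have "\<dots> = r V ?I t" using V W I restr_restr[of V W ?I t] by simp
  also have "\<dots> = r W' ?I (r V W' t)" using V W' I restr_restr[of V W' ?I t] by simp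
  also have "\<dots> = r Z ?I z" using Z W' I restr_restr[of Z W' ?I z] by simp
  finally show "\<exists>W. openin T W \<and> x \<in> W \<and> W \<subseteq> U \<and> W \<subseteq> Z \<and> r U W s = r Z W z"
    using I W W' by (intro exI[of _ ?I]) auto
qed

lemma (in set_presheaf) germ_eq_iff:
  assumes U: "openin T U" "x \<in> U" "s \<in> F U" and V: "openin T V" "x \<in> V" "t \<in> F V"
  shows "germ T F r x U s = germ T F r x V t \<longleftrightarrow>
    (\<exists>W. openin T W \<and> x \<in> W \<and> W \<subseteq> U \<inter> V \<and> r U W s = r V W t)"
proof
  assume "germ T F r x U s = germ T F r x V t"
  moreover have "(V, t) \<in> germ T F r x V t" using V unfolding germ_def by blast
  ultimately have "(V, t) \<in> germ T F r x U s" by simp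
  then show "\<exists>W. openin T W \<and> x \<in> W \<and> W \<subseteq> U \<inter> V \<and> r U W s = r V W t"
    unfolding germ_def by simp
next
  assume "\<exists>W. openin T W \<and> x \<in> W \<and> W \<subseteq> U \<inter> V \<and> r U W s = r V W t"
  then obtain W where "openin T W" "x \<in> W" "W \<subseteq> U \<inter> V" "r U W s = r V W t" by blast
  moreover from this have "W \<subseteq> V \<inter> U" "r V W t = r U W s" by auto
  ultimately show "germ T F r x U s = germ T F r x V t"
    using germ_subset[of U s V t W x] germ_subset[of V t U s W x] U V by blast
qed

text \<open>This is the uniqueness half of gluing, applied to the covering by all open sets on which
  \<open>s\<close> and \<open>t\<close> agree: both sections glue the restrictions of
  \<open>s\<close>.\<close>

lemma (in set_sheaf) eq_if_locally_eq:
  assumes U: "openin T U" "s \<in> F U" "t \<in> F U"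
    and loc: "\<And>x. x \<in> U \<Longrightarrow> \<exists>W. openin T W \<and> x \<in> W \<and> W \<subseteq> U \<and> r U W s = r U W t"
  shows "s = t"
proof -
  define \<U> where "\<U> = {W. openin T W \<and> W \<subseteq> U \<and> r U W s = r U W t}"
  have un: "\<Union>\<U> = U" using loc unfolding \<U>_def by blast
  have "\<exists>!v. v \<in> F (\<Union>\<U>) \<and> (\<forall>W\<in>\<U>. r (\<Union>\<U>) W v = r U W s)"
  proof (rule glue)
    fix W V assume "W \<in> \<U>" "V \<in> \<U>"
    then have "openin T W" "openin T V" "W \<subseteq> U" "V \<subseteq> U" unfolding \<U>_def by auto
    then show "r W (W \<inter> V) (r U W s) = r V (W \<inter> V) (r U V s)"
      using U restr_restr[of U W "W \<inter> V" s] restr_restr[of U V "W \<inter> V" s]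
      by (simp add: openin_Int)
  qed (use U restr_closed in \<open>auto simp: \<U>_def\<close>)
  moreover have "\<forall>W\<in>\<U>. r U W t = r U W s" unfolding \<U>_def by simp
  ultimately show ?thesis using U unfolding un by blast
qed

text \<open>The empty family covers the empty set and imposes no condition, so unique gluing says
  that there is exactly one section.\<close>

lemma (in set_sheaf) sections_empty: "\<exists>p. F {} = {p}"
  using glue[of "{}" undefined] by auto

text \<open>Presheaf coproducts may fail the sheaf condition. This notion keeps what is used to
  compose, invert and restrict isomorphisms: closure under the action, and its compatibility with
  restriction.\<close>

definition oset_presheaf :: "('p, 's) monoidal_space \<Rightarrow> ('p, 's, 't) oset \<Rightarrow> bool"
  where "oset_presheaf X F \<longleftrightarrow>
    set_presheaf (mtop X) (osec F) (ores F) \<and>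
    (\<forall>U. openin (mtop X) U \<longrightarrow>
       (\<forall>a\<in>carrier (sec X U). \<forall>v\<in>osec F U. oact F U a v \<in> osec F U)) \<and>
    (\<forall>U V. openin (mtop X) U \<and> openin (mtop X) V \<and> V \<subseteq> U \<longrightarrow>
       (\<forall>a\<in>carrier (sec X U). \<forall>v\<in>osec F U.
          ores F U V (oact F U a v) = oact F V (res X U V a) (ores F U V v)))"

lemma oset_presheafD:
  assumes "oset_presheaf X F"
  shows "set_presheaf (mtop X) (osec F) (ores F)"
    and "\<And>U a v. \<lbrakk>openin (mtop X) U; a \<in> carrier (sec X U); v \<in> osec F U\<rbrakk>
           \<Longrightarrow> oact F U a v \<in> osec F U"
    and "\<And>U V v. \<lbrakk>openin (mtop X) U; openin (mtop X) V; V \<subseteq> U; v \<in> osec F U\<rbrakk>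
           \<Longrightarrow> ores F U V v \<in> osec F V"
    and "\<And>U V a v. \<lbrakk>openin (mtop X) U; openin (mtop X) V; V \<subseteq> U;
             a \<in> carrier (sec X U); v \<in> osec F U\<rbrakk>
           \<Longrightarrow> ores F U V (oact F U a v) = oact F V (res X U V a) (ores F U V v)"
    and "\<And>U V W v. \<lbrakk>openin (mtop X) U; openin (mtop X) V; openin (mtop X) W; W \<subseteq> V; V \<subseteq> U;
             v \<in> osec F U\<rbrakk> \<Longrightarrow> ores F V W (ores F U V v) = ores F U W v"
  using assms unfolding oset_presheaf_def
  by (auto dest: set_presheaf.restr_closed set_presheaf.restr_restr)

lemma oset_sheaf_set_sheaf: "oset_sheaf X F \<Longrightarrow> set_sheaf (mtop X) (osec F) (ores F)"
  unfolding oset_sheaf_def by blast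

lemma oset_sheaf_imp_presheaf: "oset_sheaf X F \<Longrightarrow> oset_presheaf X F"
  unfolding oset_sheaf_def oset_presheaf_def by (simp add: set_sheaf.axioms(1))

section \<open>Coproducts before sheafification\<close>

lemma mem_osec_coprod:
  "v \<in> osec (presheaf_coprod n L) U \<longleftrightarrow> fst v < n \<and> snd v \<in> osec (L (fst v)) U"
  by (cases v) (simp add: presheaf_coprod_def)

lemma ores_coprod:
  "ores (presheaf_coprod n L) U V v = (fst v, ores (L (fst v)) U V (snd v))"
  by (cases v) (simp add: presheaf_coprod_def)

lemma oact_coprod:
  "oact (presheaf_coprod n L) U a v = (fst v, oact (L (fst v)) U a (snd v))"
  by (cases v) (simp add: presheaf_coprod_def)

lemma oset_presheaf_coprod:
  assumes L: "\<And>i. i < n \<Longrightarrow> oset_presheaf X (L i)"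
  shows "oset_presheaf X (presheaf_coprod n L)"
proof -
  have "set_presheaf (mtop X) (osec (presheaf_coprod n L)) (ores (presheaf_coprod n L))"
  proof (unfold_locales, goal_cases)
    case (1 U V s) then show ?case
      using oset_presheafD(3)[OF L] by (simp add: mem_osec_coprod ores_coprod oact_coprod)
  next
    case (2 U s) then show ?case
      using set_presheaf.restr_id[OF oset_presheafD(1)[OF L]] by (simp add: mem_osec_coprod ores_coprod oact_coprod)
  next
    case (3 U V W s) then show ?case
      using oset_presheafD(5)[OF L, of "fst s" U V W "snd s"] by (simp add: mem_osec_coprod ores_coprod oact_coprod)
  qed
  then show ?thesis
    using oset_presheafD(2,4)[OF L] unfolding oset_presheaf_def by (simp add: mem_osec_coprod ores_coprod oact_coprod)
qed

lemma structure_oset_sheaf: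
  assumes X: "is_monoidal_space X"
  shows "oset_sheaf X (structure_oset X)"
proof -
  have O: "osec (structure_oset X) = (\<lambda>U. carrier (sec X U))" "ores (structure_oset X) = res X"
    "oact (structure_oset X) U a b = a \<otimes>\<^bsub>sec X U\<^esub> b" for U a b
    by (simp_all add: structure_oset_def)
  have sh: "set_sheaf (mtop X) (\<lambda>U. carrier (sec X U)) (res X)"
    using X unfolding is_monoidal_space_def by (elim conjE)
  have mon: "monoid (sec X U)" if "openin (mtop X) U" for U
    using X that comm_monoid.axioms(1) unfolding is_monoidal_space_def by metis
  have hom: "res X U V (a \<otimes>\<^bsub>sec X U\<^esub> b) = res X U V a \<otimes>\<^bsub>sec X V\<^esub> res X U V b"
    if "openin (mtop X) U" "openin (mtop X) V" "V \<subseteq> U"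
      "a \<in> carrier (sec X U)" "b \<in> carrier (sec X U)" for U V a b
  proof -
    have "res X U V \<in> monoid_hom (sec X U) (sec X V)"
      using X that(1-3) unfolding is_monoidal_space_def by metis
    then show ?thesis using that(4,5) unfolding monoid_hom_def by (simp add: hom_mult)
  qed
  show ?thesis
    unfolding oset_sheaf_def O
  proof (intro conjI allI impI ballI sh, goal_cases)
    case (1 U a v) then show ?case using monoid.m_closed[OF mon] by metis
  next
    case (2 U v) then show ?case using monoid.l_one[OF mon] by metis
  next
    case (3 U a b v) then show ?case using monoid.m_assoc[OF mon] by metis
  next
    case (4 U V a v) then show ?case using hom by metis
  qed
qed

text \<open>
  A presheaf coproduct of \<open>n \<noteq> 1\<close> sheaves violates the sheaf condition at the empty set, but on an
  irreducible space that is the only obstruction. So isomorphisms are compared over the nonempty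
  open sets.
\<close>

definition nonempty_iso ::
  "('p, 's) monoidal_space \<Rightarrow> 'p set \<Rightarrow> ('p, 's, 't) oset \<Rightarrow> ('p, 's, 'u) oset
     \<Rightarrow> ('p set \<Rightarrow> 't \<Rightarrow> 'u) \<Rightarrow> bool"
  where "nonempty_iso X U F G \<eta> \<longleftrightarrow>
    (\<forall>V. openin (mtop X) V \<and> V \<subseteq> U \<and> V \<noteq> {} \<longrightarrow>
       bij_betw (\<eta> V) (osec F V) (osec G V) \<and>
       (\<forall>a\<in>carrier (sec X V). \<forall>v\<in>osec F V. \<eta> V (oact F V a v) = oact G V a (\<eta> V v)) \<and>
       (\<forall>W. openin (mtop X) W \<and> W \<subseteq> V \<and> W \<noteq> {} \<longrightarrow>
          (\<forall>v\<in>osec F V. \<eta> W (ores F V W v) = ores G V W (\<eta> V v))))"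

lemma nonempty_isoD:
  assumes "nonempty_iso X U F G \<eta>" "openin (mtop X) V" "V \<subseteq> U" "V \<noteq> {}"
  shows "bij_betw (\<eta> V) (osec F V) (osec G V)"
    and "v \<in> osec F V \<Longrightarrow> \<eta> V v \<in> osec G V"
    and "\<lbrakk>a \<in> carrier (sec X V); v \<in> osec F V\<rbrakk> \<Longrightarrow> \<eta> V (oact F V a v) = oact G V a (\<eta> V v)"
    and "\<lbrakk>openin (mtop X) W; W \<subseteq> V; W \<noteq> {}; v \<in> osec F V\<rbrakk>
           \<Longrightarrow> \<eta> W (ores F V W v) = ores G V W (\<eta> V v)"
proof -
  show "bij_betw (\<eta> V) (osec F V) (osec G V)" using assms unfolding nonempty_iso_def by blast
  then show "v \<in> osec F V \<Longrightarrow> \<eta> V v \<in> osec G V" by (rule bij_betwE[rule_format])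
qed (use assms in \<open>unfold nonempty_iso_def, blast+\<close>)

lemma nonempty_iso_subset:
  "\<lbrakk>nonempty_iso X U F G \<eta>; U' \<subseteq> U\<rbrakk> \<Longrightarrow> nonempty_iso X U' F G \<eta>"
  unfolding nonempty_iso_def by (meson subset_trans)

lemma nonempty_iso_trans:
  assumes "nonempty_iso X U F G \<eta>" "nonempty_iso X U G H \<theta>"
  shows "nonempty_iso X U F H (\<lambda>V. \<theta> V \<circ> \<eta> V)"
  unfolding nonempty_iso_def
proof (intro allI impI conjI ballI, goal_cases)
  case (1 V) then show ?case
    using bij_betw_trans[OF nonempty_isoD(1)[OF assms(1)] nonempty_isoD(1)[OF assms(2)]] by simp
next
  case (2 V a v) then show ?case
    using nonempty_isoD(2,3)[OF assms(1), of V] nonempty_isoD(3)[OF assms(2), of V] by simp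
next
  case (3 V W v)
  then show ?case
    using nonempty_isoD(2,4)[OF assms(1), of V] nonempty_isoD(4)[OF assms(2), of V] by simp
qed

text \<open>\<open>inv_into\<close> undoes \<open>\<eta>\<close> only on sections of
  \<open>F\<close>, so the inverse is compatible with action and restriction because these lead from
  sections of \<open>F\<close> to sections of \<open>F\<close>.\<close>

lemma nonempty_iso_sym:
  assumes F: "oset_presheaf X F" and \<eta>: "nonempty_iso X U F G \<eta>"
  shows "nonempty_iso X U G F (\<lambda>V. inv_into (osec F V) (\<eta> V))"
proof -
  have eq: "inv_into (osec F V) (\<eta> V) (\<eta> V v) = v"
    if "openin (mtop X) V" "V \<subseteq> U" "V \<noteq> {}" "v \<in> osec F V" for V v
    using nonempty_isoD(1)[OF \<eta> that(1-3)] that(4) bij_betw_inv_into_left by metis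
  have pre: "\<exists>v\<in>osec F V. w = \<eta> V v"
    if "openin (mtop X) V" "V \<subseteq> U" "V \<noteq> {}" "w \<in> osec G V" for V w
    using nonempty_isoD(1)[OF \<eta> that(1-3)] that(4) unfolding bij_betw_def by blast
  show ?thesis
    unfolding nonempty_iso_def
  proof (intro allI impI conjI ballI, goal_cases)
    case (1 V) then show ?case using bij_betw_inv_into[OF nonempty_isoD(1)[OF \<eta>]] by simp
  next
    case (2 V a w)
    then obtain v where "v \<in> osec F V" "w = \<eta> V v" using pre by blast
    then show ?case
      using 2 eq oset_presheafD(2)[OF F] by (simp flip: nonempty_isoD(3)[OF \<eta>])
  next
    case (3 V W w)
    then obtain v where "v \<in> osec F V" "w = \<eta> V v" using pre by blast
    moreover have "W \<subseteq> U" using 3 by blast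
    ultimately show ?case
      using 3 eq oset_presheafD(3)[OF F] by (simp flip: nonempty_isoD(4)[OF \<eta>, of V])
  qed
qed

text \<open>Follows from the sheaf property and is exactly what extends an isomorphism over the
  nonempty open sets to the empty set.\<close>

definition terminal_at_empty :: "('p, 's) monoidal_space \<Rightarrow> ('p, 's, 't) oset \<Rightarrow> bool"
  where "terminal_at_empty X F \<longleftrightarrow>
    (\<exists>p. osec F {} = {p} \<and> (\<forall>a\<in>carrier (sec X {}). oact F {} a p = p) \<and>
         (\<forall>U. openin (mtop X) U \<longrightarrow> (\<forall>v\<in>osec F U. ores F U {} v = p)))"

lemma terminal_at_empty_sheaf:
  assumes "oset_sheaf X F"
  shows "terminal_at_empty X F"
proof -
  obtain p where p: "osec F {} = {p}"
    using set_sheaf.sections_empty[OF oset_sheaf_set_sheaf[OF assms]] by blast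
  have "oact F {} a p = p" if "a \<in> carrier (sec X {})" for a
    using oset_presheafD(2)[OF oset_sheaf_imp_presheaf[OF assms], of "{}" a p] that p by simp
  moreover have "ores F U {} v = p" if "openin (mtop X) U" "v \<in> osec F U" for U v
    using oset_presheafD(3)[OF oset_sheaf_imp_presheaf[OF assms], of U "{}" v] that p by simp
  ultimately show ?thesis
    using p unfolding terminal_at_empty_def by (intro exI[of _ p]) simp
qed

text \<open>Sections of a sheafification are extensional functions, and there is only one of these
  on the empty set. So the coproduct need not first be shown to be a sheaf.\<close>

lemma terminal_at_empty_coprod: "terminal_at_empty X (oset_coprod X n L)"
proof -
  have "osec (oset_coprod X n L) {} = {\<lambda>_. undefined}"
    unfolding oset_coprod_def oset_sheafify_def sheafify_sections_def by simp
  moreover have "oact (oset_coprod X n L) {} a v = (\<lambda>_. undefined)"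
    "ores (oset_coprod X n L) U {} v = (\<lambda>_. undefined)" for a v U
    unfolding oset_coprod_def oset_sheafify_def by (simp_all add: restrict_def)
  ultimately show ?thesis
    unfolding terminal_at_empty_def by (intro exI[of _ "\<lambda>_. undefined"]) simp
qed

lemma oset_isomorphicI:
  assumes U: "openin (mtop X) U" and \<eta>: "nonempty_iso X U F G \<eta>"
    and F: "terminal_at_empty X F" and G: "terminal_at_empty X G"
  shows "oset_isomorphic (open_subspace X U) F G"
proof -
  obtain p where p: "osec F {} = {p}" "\<forall>a\<in>carrier (sec X {}). oact F {} a p = p"
    "\<forall>U. openin (mtop X) U \<longrightarrow> (\<forall>v\<in>osec F U. ores F U {} v = p)"
    using F unfolding terminal_at_empty_def by (elim exE conjE) (rule that)
  obtain q where q: "osec G {} = {q}" "\<forall>a\<in>carrier (sec X {}). oact G {} a q = q"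
    "\<forall>U. openin (mtop X) U \<longrightarrow> (\<forall>v\<in>osec G U. ores G U {} v = q)"
    using G unfolding terminal_at_empty_def by (elim exE conjE) (rule that)
  \<comment> \<open>Nothing is known about \<open>\<eta>\<close> at the empty set; the constant map
    to the single section \<open>q\<close> replaces it there.\<close>
  define \<theta> where "\<theta> V = (if V = {} then \<lambda>_. q else \<eta> V)" for V
  have \<theta>: "\<theta> {} = (\<lambda>_. q)" "V \<noteq> {} \<Longrightarrow> \<theta> V = \<eta> V" for V
    by (simp_all add: \<theta>_def)
  have op: "openin (mtop (open_subspace X U)) V \<longleftrightarrow> openin (mtop X) V \<and> V \<subseteq> U" for V
    using U by (simp add: open_subspace_def openin_open_subtopology)
  have sec: "sec (open_subspace X U) = sec X" "res (open_subspace X U) = res X"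
    by (simp_all add: open_subspace_def)
  have "oset_iso (open_subspace X U) F G \<theta>"
    unfolding oset_iso_def op sec
  proof (intro allI impI conjI ballI, elim conjE, goal_cases)
    case (1 V)
    then show ?case
    proof (cases "V = {}")
      case True
      then show ?thesis by (simp add: \<theta> p(1) q(1) bij_betw_def)
    next
      case False
      then show ?thesis using nonempty_isoD(1)[OF \<eta>, of V] 1 \<theta>(2) by metis
    qed
  next
    case (2 V a v)
    then show ?case
    proof (cases "V = {}")
      case True
      then show ?thesis using 2 q(2) \<theta>(1) by metis
    next
      case False
      then show ?thesis using nonempty_isoD(3)[OF \<eta>, of V] 2 \<theta>(2) by metis
    qed
  next
    case (3 V W v)
    then have V: "openin (mtop X) V" "openin (mtop X) W" "V \<subseteq> U" "W \<subseteq> V" by auto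
    show ?case
    proof (cases "W = {}")
      case True
      have "\<theta> V v \<in> osec G V"
        using nonempty_isoD(2)[OF \<eta>, of V v] 3 V q(1) \<theta> by (cases "V = {}") auto
      then show ?thesis using True V q(3) \<theta>(1) by metis
    next
      case False
      then have "V \<noteq> {}" using V by blast
      then show ?thesis using False nonempty_isoD(4)[OF \<eta>, of V W v] 3 V \<theta>(2) by metis
    qed
  qed
  then show ?thesis unfolding oset_isomorphic_def by blast
qed

lemma oset_isomorphicD:
  assumes "openin (mtop X) U" "oset_isomorphic (open_subspace X U) F G"
  shows "\<exists>\<eta>. nonempty_iso X U F G \<eta>"
proof -
  obtain \<eta> where "oset_iso (open_subspace X U) F G \<eta>"
    using assms(2) unfolding oset_isomorphic_def by blast
  moreover have "openin (mtop (open_subspace X U)) V \<longleftrightarrow> openin (mtop X) V \<and> V \<subseteq> U" for V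
    using assms(1) by (simp add: open_subspace_def openin_open_subtopology)
  moreover have "sec (open_subspace X U) = sec X" by (simp add: open_subspace_def)
  ultimately have "nonempty_iso X U F G \<eta>"
    unfolding oset_iso_def nonempty_iso_def by simp (meson order_trans)
  then show ?thesis by blast
qed

section \<open>The unit of sheafification for coproducts on an irreducible space\<close>

definition coprod_section ::
  "('p, 's) monoidal_space \<Rightarrow> nat \<Rightarrow> (nat \<Rightarrow> ('p, 's, 't) oset) \<Rightarrow> 'p set \<Rightarrow> nat \<times> 't
     \<Rightarrow> 'p \<Rightarrow> ('p set \<times> nat \<times> 't) set"
  where "coprod_section X n L U s =
    (\<lambda>x\<in>U. germ (mtop X) (osec (presheaf_coprod n L)) (ores (presheaf_coprod n L)) x U s)"

text \<open>Over a nonempty open set the local pieces of a section can be taken over nonempty sets,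
  which pairwise meet. So their indices coincide, and pieces with a common index \<open>i\<close>
  glue in the sheaf \<open>L i\<close>.\<close>

lemma nonempty_iso_coprod_section:
  assumes X: "is_monoidal_space X" and irr: "irreducible_top (mtop X)"
    and L: "\<And>i. i < n \<Longrightarrow> oset_sheaf X (L i)"
  shows "nonempty_iso X U (presheaf_coprod n L) (oset_coprod X n L) (coprod_section X n L)"
proof -
  let ?P = "presheaf_coprod n L" and ?T = "mtop X"
  let ?g = "germ ?T (osec ?P) (ores ?P)"
  have P: "oset_presheaf X ?P"
    using oset_presheaf_coprod L oset_sheaf_imp_presheaf by blast
  interpret set_presheaf ?T "osec ?P" "ores ?P" by (rule oset_presheafD(1)[OF P])
  interpret O: set_sheaf ?T "\<lambda>U. carrier (sec X U)" "res X"
    using X unfolding is_monoidal_space_def by blast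
  have osec: "osec ?P V = (SIGMA i:{..<n}. osec (L i) V)" for V
    by (simp add: presheaf_coprod_def)
  have ores: "ores ?P V W (i, v) = (i, ores (L i) V W v)" for V W i v
    by (simp add: presheaf_coprod_def)
  \<comment> \<open>The germ at a single point determines the index, which is why \<open>V\<close>
    is nonempty. The second components then agree locally, hence globally, in
    \<open>L i\<close>.\<close>
  have inj: "s = t"
    if V: "openin ?T V" "V \<noteq> {}" and s: "s \<in> osec ?P V" and t: "t \<in> osec ?P V"
      and eq: "\<And>x. x \<in> V \<Longrightarrow> ?g x V s = ?g x V t" for V s t
  proof -
    have loc: "\<exists>W. openin ?T W \<and> x \<in> W \<and> W \<subseteq> V \<and> ores ?P V W s = ores ?P V W t"
      if "x \<in> V" for x
      using germ_eq_iff[OF V(1) that s V(1) that t] eq[OF that] by simp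
    obtain i v where i: "s = (i, v)" "i < n" "v \<in> osec (L i) V" using s osec by auto
    obtain j w where j: "t = (j, w)" "w \<in> osec (L j) V" using t osec by auto
    have "i = j" using loc V i j ores by fastforce
    moreover have "v = w"
      using set_sheaf.eq_if_locally_eq[OF oset_sheaf_set_sheaf[OF L[OF i(2)]] V(1) i(3), of w]
        loc i j ores \<open>i = j\<close> by auto
    ultimately show ?thesis using i j by simp
  qed
  have germ_res: "?g x V s = ?g x W (ores ?P V W s)"
    if "openin ?T V" "openin ?T W" "W \<subseteq> V" "x \<in> W" "s \<in> osec ?P V" for V W s x
    using that restr_closed restr_id[of W "ores ?P V W s"]
    by (subst germ_eq_iff) (auto intro!: exI[of _ W])
  have surj: "\<exists>s\<in>osec ?P V. \<sigma> = coprod_section X n L V s"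
    if V: "openin ?T V" "V \<noteq> {}" and \<sigma>: "\<sigma> \<in> osec (oset_coprod X n L) V" for V \<sigma>
  proof -
    have ext: "\<sigma> \<in> extensional V"
      and loc: "\<forall>x\<in>V. \<exists>W s. openin ?T W \<and> x \<in> W \<and> W \<subseteq> V \<and> s \<in> osec ?P W \<and>
                 (\<forall>y\<in>W. \<sigma> y = ?g y W s)"
      using \<sigma> unfolding oset_coprod_def oset_sheafify_def sheafify_sections_def by auto
    define \<U> where "\<U> = {W. openin ?T W \<and> W \<noteq> {} \<and> W \<subseteq> V \<and>
                          (\<exists>s\<in>osec ?P W. \<forall>y\<in>W. \<sigma> y = ?g y W s)}"
    have un: "\<Union>\<U> = V"
    proof
      show "\<Union>\<U> \<subseteq> V" unfolding \<U>_def by (rule Union_least) simp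
      show "V \<subseteq> \<Union>\<U>"
      proof
        fix x assume "x \<in> V"
        then obtain W s where W: "openin ?T W" "x \<in> W" "W \<subseteq> V" "s \<in> osec ?P W"
          "\<forall>y\<in>W. \<sigma> y = ?g y W s"
          using loc by metis
        then have "W \<in> \<U>" unfolding \<U>_def by (intro CollectI) (metis empty_iff)
        then show "x \<in> \<Union>\<U>" using W(2) by (rule UnionI)
      qed
    qed
    define \<tau> where "\<tau> W = (SOME s. s \<in> osec ?P W \<and> (\<forall>y\<in>W. \<sigma> y = ?g y W s))" for W
    have \<U>: "openin ?T W" "W \<noteq> {}" "W \<subseteq> V"
      and ex: "\<exists>s. s \<in> osec ?P W \<and> (\<forall>y\<in>W. \<sigma> y = ?g y W s)" if "W \<in> \<U>" for W
      using that unfolding \<U>_def Bex_def by simp_all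
    have \<tau>: "\<tau> W \<in> osec ?P W" "y \<in> W \<Longrightarrow> \<sigma> y = ?g y W (\<tau> W)" if "W \<in> \<U>" for W y
    proof -
      have "\<tau> W \<in> osec ?P W \<and> (\<forall>y\<in>W. \<sigma> y = ?g y W (\<tau> W))"
        unfolding \<tau>_def by (rule someI_ex[OF ex[OF that]])
      then show "\<tau> W \<in> osec ?P W" "y \<in> W \<Longrightarrow> \<sigma> y = ?g y W (\<tau> W)" by blast+
    qed
    \<comment> \<open>The representatives \<open>\<tau>\<close> are arbitrary choices, but on an
      overlap they have the same germs, namely the values of \<open>\<sigma>\<close>; injectivity
      over the nonempty overlap makes their restrictions equal.\<close>
    have agree: "ores ?P W (W \<inter> Z) (\<tau> W) = ores ?P Z (W \<inter> Z) (\<tau> Z)"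
      if W: "W \<in> \<U>" and Z: "Z \<in> \<U>" for W Z
    proof (rule inj)
      show op: "openin ?T (W \<inter> Z)" using \<U> that by blast
      show "W \<inter> Z \<noteq> {}" using irreducible_topD[OF irr] \<U> that by metis
      show "ores ?P W (W \<inter> Z) (\<tau> W) \<in> osec ?P (W \<inter> Z)"
        "ores ?P Z (W \<inter> Z) (\<tau> Z) \<in> osec ?P (W \<inter> Z)"
        using restr_closed op \<U> \<tau> W Z by auto
      fix x assume x: "x \<in> W \<inter> Z"
      have "?g x (W \<inter> Z) (ores ?P W (W \<inter> Z) (\<tau> W)) = ?g x W (\<tau> W)"
        using germ_res[OF \<U>(1)[OF W] op _ x \<tau>(1)[OF W]] by simp
      also have "\<dots> = ?g x Z (\<tau> Z)" using \<tau>(2)[OF W] \<tau>(2)[OF Z] x by (metis IntD1 IntD2)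
      also have "\<dots> = ?g x (W \<inter> Z) (ores ?P Z (W \<inter> Z) (\<tau> Z))"
        using germ_res[OF \<U>(1)[OF Z] op _ x \<tau>(1)[OF Z]] by simp
      finally show "?g x (W \<inter> Z) (ores ?P W (W \<inter> Z) (\<tau> W)) =
                    ?g x (W \<inter> Z) (ores ?P Z (W \<inter> Z) (\<tau> Z))" .
    qed
    \<comment> \<open>One member fixes the index for all, since each of them meets \<open>W0\<close>
      and restriction keeps the index.\<close>
    obtain W0 where W0: "W0 \<in> \<U>" using un V by blast
    obtain i where i: "fst (\<tau> W0) = i" "i < n" using \<tau>(1)[OF W0] osec by auto
    have fst_res: "fst (ores ?P A B s) = fst s" for A B s by (cases s) (simp add: ores)
    have \<tau>i: "\<tau> W = (i, snd (\<tau> W))" if "W \<in> \<U>" for W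
      using agree[OF that W0] fst_res i by (metis prod.collapse)
    interpret Li: set_sheaf ?T "osec (L i)" "ores (L i)"
      by (rule oset_sheaf_set_sheaf[OF L[OF i(2)]])
    have "\<exists>!v. v \<in> osec (L i) (\<Union>\<U>) \<and> (\<forall>W\<in>\<U>. ores (L i) (\<Union>\<U>) W v = snd (\<tau> W))"
    proof (rule Li.glue)
      fix W Z assume WZ: "W \<in> \<U>" "Z \<in> \<U>"
      show "ores (L i) W (W \<inter> Z) (snd (\<tau> W)) = ores (L i) Z (W \<inter> Z) (snd (\<tau> Z))"
        using agree[OF WZ] \<tau>i[OF WZ(1)] \<tau>i[OF WZ(2)] ores by (metis snd_conv)
    next
      fix W assume "W \<in> \<U>"
      then show "snd (\<tau> W) \<in> osec (L i) W" using \<tau>(1)[of W] \<tau>i[of W] osec[of W]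
        by (metis (no_types, lifting) mem_Sigma_iff)
    qed (use \<U> in blast)
    then obtain v where v: "v \<in> osec (L i) V" "\<And>W. W \<in> \<U> \<Longrightarrow> ores (L i) V W v = snd (\<tau> W)"
      unfolding un by blast
    have iv: "(i, v) \<in> osec ?P V" using v i osec by simp
    have "\<sigma> x = ?g x V (i, v)" if x: "x \<in> V" for x
    proof -
      obtain W where W: "W \<in> \<U>" "x \<in> W" using x unfolding un[symmetric] by (rule UnionE)
      have "ores ?P V W (i, v) = \<tau> W" using v(2)[OF W(1)] \<tau>i[OF W(1)] ores by simp
      then show ?thesis
        using germ_res[OF V(1) \<U>(1)[OF W(1)] \<U>(3)[OF W(1)] W(2) iv] \<tau>(2)[OF W] by simp
    qed
    then have "\<sigma> = coprod_section X n L V (i, v)"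
      unfolding coprod_section_def by (intro extensionalityI[OF ext restrict_extensional]) simp
    then show ?thesis using iv by blast
  qed
  have clos: "coprod_section X n L V s \<in> osec (oset_coprod X n L) V"
    if "openin ?T V" "s \<in> osec ?P V" for V s
    unfolding oset_coprod_def oset_sheafify_def sheafify_sections_def coprod_section_def oset.simps
  proof (intro CollectI conjI ballI)
    fix x assume "x \<in> V"
    then show "\<exists>W t. openin ?T W \<and> x \<in> W \<and> W \<subseteq> V \<and> t \<in> osec ?P W \<and>
        (\<forall>y\<in>W. (\<lambda>x\<in>V. ?g x V s) y = ?g y W t)"
      using that by (intro exI[of _ V] exI[of _ s]) simp
  qed simp
  have act: "coprod_section X n L V (oact ?P V a s) = oact (oset_coprod X n L) V a
               (coprod_section X n L V s)"
    if V: "openin ?T V" and a: "a \<in> carrier (sec X V)" and s: "s \<in> osec ?P V" for V a s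
  proof -
    let ?act = "\<lambda>x W t. ?g x (V \<inter> W) (oact ?P (V \<inter> W) (res X V (V \<inter> W) a) (ores ?P W (V \<inter> W) t))"
    have as: "oact ?P V a s \<in> osec ?P V" using oset_presheafD(2)[OF P] V a s by blast
    have "(\<Union>(W, t)\<in>?g x V s. ?act x W t) = ?g x V (oact ?P V a s)" if x: "x \<in> V" for x
    proof -
      \<comment> \<open>The action on germs is a union over all representatives. Every term is shown
        to be the same germ, and the representative \<open>(V, s)\<close> shows that there is at
        least one term.\<close>
      have "?act x W t = ?g x V (oact ?P V a s)" if Wt: "(W, t) \<in> ?g x V s" for W t
      proof -
        obtain Z where W: "openin ?T W" "x \<in> W" "t \<in> osec ?P W"
          and Z: "openin ?T Z" "x \<in> Z" "Z \<subseteq> V \<inter> W" "ores ?P V Z s = ores ?P W Z t"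
          using Wt unfolding germ_def mem_Collect_eq case_prod_conv by (elim exE conjE) (rule that)
        have VW: "openin ?T (V \<inter> W)" using V W by blast
        have a': "res X V (V \<inter> W) a \<in> carrier (sec X (V \<inter> W))"
          using O.restr_closed[of V "V \<inter> W" a] V VW a by simp
        have t': "ores ?P W (V \<inter> W) t \<in> osec ?P (V \<inter> W)"
          using restr_closed[of W "V \<inter> W" t] W VW by simp
        have "ores ?P (V \<inter> W) Z (oact ?P (V \<inter> W) (res X V (V \<inter> W) a) (ores ?P W (V \<inter> W) t))
            = oact ?P Z (res X (V \<inter> W) Z (res X V (V \<inter> W) a)) (ores ?P (V \<inter> W) Z (ores ?P W (V \<inter> W) t))"
          using oset_presheafD(4)[OF P VW Z(1) Z(3) a' t'] .
        also have "\<dots> = oact ?P Z (res X V Z a) (ores ?P W Z t)"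
          using O.restr_restr[of V "V \<inter> W" Z a] restr_restr[of W "V \<inter> W" Z t] V VW W Z a by simp
        also have "\<dots> = ores ?P V Z (oact ?P V a s)"
          using oset_presheafD(4)[OF P V Z(1) _ a s] Z by simp
        finally show ?thesis
          using germ_eq_iff[of "V \<inter> W" x _ V "oact ?P V a s"] oset_presheafD(2)[OF P VW a' t']
            VW V W x as Z by blast
      qed
      moreover have "(V, s) \<in> ?g x V s" using V s x unfolding germ_def by blast
      ultimately show ?thesis by blast
    qed
    then show ?thesis
      unfolding oset_coprod_def oset_sheafify_def coprod_section_def oset.simps
      by (intro restrict_ext) simp
  qed
  have resn: "coprod_section X n L W (ores ?P V W s) = ores (oset_coprod X n L) V W
               (coprod_section X n L V s)"
    if "openin ?T V" "openin ?T W" "W \<subseteq> V" "s \<in> osec ?P V" for V W s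
    unfolding oset_coprod_def oset_sheafify_def coprod_section_def oset.simps
  proof (intro restrict_ext)
    fix x assume x: "x \<in> W"
    then show "?g x W (ores ?P V W s) = (\<lambda>x\<in>V. ?g x V s) x"
      using germ_res[OF that(1-3) x that(4)] that(3) by (simp add: subsetD)
  qed
  show ?thesis
    unfolding nonempty_iso_def
  proof (intro allI impI conjI ballI, goal_cases)
    case (1 V)
    have "inj_on (coprod_section X n L V) (osec ?P V)"
    proof (rule inj_onI)
      fix s t assume st: "s \<in> osec ?P V" "t \<in> osec ?P V"
        and eq: "coprod_section X n L V s = coprod_section X n L V t"
      show "s = t"
      proof (rule inj)
        fix x assume "x \<in> V"
        then show "?g x V s = ?g x V t"
          using fun_cong[OF eq, of x] unfolding coprod_section_def by simp
      qed (use 1 st in auto)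
    qed
    moreover have "coprod_section X n L V ` osec ?P V = osec (oset_coprod X n L) V"
    proof
      show "coprod_section X n L V ` osec ?P V \<subseteq> osec (oset_coprod X n L) V"
        using clos 1 by (intro image_subsetI) simp
      show "osec (oset_coprod X n L) V \<subseteq> coprod_section X n L V ` osec ?P V"
      proof
        fix \<sigma> assume "\<sigma> \<in> osec (oset_coprod X n L) V"
        then obtain s where "s \<in> osec ?P V" "\<sigma> = coprod_section X n L V s"
          using surj[of V \<sigma>] 1 by (elim conjE) metis
        then show "\<sigma> \<in> coprod_section X n L V ` osec ?P V" by (rule rev_image_eqI)
      qed
    qed
    ultimately show ?case unfolding bij_betw_def ..
  next
    case (2 V a s) then show ?case using act by simp
  next
    case (3 V W s) then show ?case using resn by simp
  qed
qed

text \<open>Composing with the unit of sheafification or its inverse trades families of germs for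
  pairs of an index and a section. The value at the empty set, forgotten on the way, is restored by
  \<open>oset_isomorphicI\<close>.\<close>

lemma nonempty_iso_coprod_iff:
  assumes X: "is_monoidal_space X" and irr: "irreducible_top (mtop X)"
    and U: "openin (mtop X) U" and F: "oset_sheaf X F" and L: "\<And>i. i < n \<Longrightarrow> oset_sheaf X (L i)"
  shows "oset_isomorphic (open_subspace X U) F (oset_coprod X n L) \<longleftrightarrow>
    (\<exists>\<eta>. nonempty_iso X U F (presheaf_coprod n L) \<eta>)"
proof -
  have P: "oset_presheaf X (presheaf_coprod n L)"
    using oset_presheaf_coprod oset_sheaf_imp_presheaf[OF L] by metis
  have \<kappa>: "nonempty_iso X U (presheaf_coprod n L) (oset_coprod X n L) (coprod_section X n L)"
    by (rule nonempty_iso_coprod_section[OF X irr L])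
  show ?thesis
  proof
    assume "oset_isomorphic (open_subspace X U) F (oset_coprod X n L)"
    then obtain \<eta> where "nonempty_iso X U F (oset_coprod X n L) \<eta>"
      using oset_isomorphicD[OF U] by metis
    from nonempty_iso_trans[OF this nonempty_iso_sym[OF P \<kappa>]]
    show "\<exists>\<eta>. nonempty_iso X U F (presheaf_coprod n L) \<eta>" by (intro exI)
  next
    assume "\<exists>\<eta>. nonempty_iso X U F (presheaf_coprod n L) \<eta>"
    then obtain \<eta> where "nonempty_iso X U F (presheaf_coprod n L) \<eta>" ..
    from nonempty_iso_trans[OF this \<kappa>]
    show "oset_isomorphic (open_subspace X U) F (oset_coprod X n L)"
      by (rule oset_isomorphicI[OF U _ terminal_at_empty_sheaf[OF F] terminal_at_empty_coprod])
  qed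
qed

section \<open>Bundles in terms of presheaf coproducts\<close>

lemma open_subspace_topspace: "open_subspace X (topspace (mtop X)) = X"
  unfolding open_subspace_def by (simp add: subtopology_topspace)

lemma vector_bundle_iff:
  assumes X: "is_monoidal_space X" and irr: "irreducible_top (mtop X)"
  shows "vector_bundle X n F \<longleftrightarrow> oset_sheaf X F \<and>
    (\<forall>x\<in>topspace (mtop X). \<exists>U. openin (mtop X) U \<and> x \<in> U \<and>
       (\<exists>\<eta>. nonempty_iso X U F (presheaf_coprod n (\<lambda>_. structure_oset X)) \<eta>))"
  using nonempty_iso_coprod_iff[OF X irr _ _ structure_oset_sheaf[OF X], of _ F n]
  unfolding vector_bundle_def free_oset_def by metis

lemma nonempty_iso_coprod_one: "nonempty_iso X U (presheaf_coprod 1 (\<lambda>_. G)) G (\<lambda>_. snd)"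
proof -
  \<comment> \<open>The only index below 1 is 0, so forgetting it loses nothing.\<close>
  have "bij_betw snd (osec (presheaf_coprod 1 (\<lambda>_. G)) V) (osec G V)" for V
    by (rule bij_betw_byWitness[of _ "Pair 0"]) (auto simp: presheaf_coprod_def)
  then show ?thesis unfolding nonempty_iso_def by (simp add: ores_coprod oact_coprod)
qed

lemma line_bundle_iff:
  assumes X: "is_monoidal_space X" and irr: "irreducible_top (mtop X)"
  shows "line_bundle X F \<longleftrightarrow> oset_sheaf X F \<and>
    (\<forall>x\<in>topspace (mtop X). \<exists>U. openin (mtop X) U \<and> x \<in> U \<and>
       (\<exists>\<eta>. nonempty_iso X U F (structure_oset X) \<eta>))"
proof -
  let ?O = "structure_oset X" and ?P = "presheaf_coprod 1 (\<lambda>_. structure_oset X)"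
  have P: "oset_presheaf X ?P"
    using oset_presheaf_coprod oset_sheaf_imp_presheaf[OF structure_oset_sheaf[OF X]] by metis
  have "(\<exists>\<eta>. nonempty_iso X U F ?P \<eta>) \<longleftrightarrow> (\<exists>\<eta>. nonempty_iso X U F ?O \<eta>)" for U
  proof
    assume "\<exists>\<eta>. nonempty_iso X U F ?P \<eta>"
    then obtain \<eta> where "nonempty_iso X U F ?P \<eta>" ..
    from nonempty_iso_trans[OF this nonempty_iso_coprod_one]
    show "\<exists>\<eta>. nonempty_iso X U F ?O \<eta>" by (intro exI)
  next
    assume "\<exists>\<eta>. nonempty_iso X U F ?O \<eta>"
    then obtain \<eta> where "nonempty_iso X U F ?O \<eta>" ..
    from nonempty_iso_trans[OF this nonempty_iso_sym[OF P nonempty_iso_coprod_one]]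
    show "\<exists>\<eta>. nonempty_iso X U F ?P \<eta>" by (intro exI)
  qed
  then show ?thesis unfolding vector_bundle_iff[OF X irr] by simp
qed


section \<open>Components\<close>

text \<open>A generator over a single nonempty open \<open>V\<close> is enough, since on an
  irreducible space every nonempty open set can be shrunk to meet \<open>V\<close>. The condition
  becomes weaker as \<open>U\<close> grows, so it may be verified on a small neighbourhood.\<close>

definition locally_cyclic :: "('p, 's) monoidal_space \<Rightarrow> 'p set \<Rightarrow> ('p, 's, 't) oset \<Rightarrow> bool"
  where "locally_cyclic X U F \<longleftrightarrow>
    (\<exists>V e. openin (mtop X) V \<and> V \<subseteq> U \<and> V \<noteq> {} \<and> e \<in> osec F V \<and>
       (\<forall>W. openin (mtop X) W \<and> W \<subseteq> V \<and> W \<noteq> {} \<longrightarrow>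
          (\<forall>s\<in>osec F W. \<exists>a\<in>carrier (sec X W). s = oact F W a (ores F V W e))))"

lemma locally_cyclic_mono: "\<lbrakk>locally_cyclic X V F; V \<subseteq> U\<rbrakk> \<Longrightarrow> locally_cyclic X U F"
  unfolding locally_cyclic_def by (meson order_trans)

text \<open>The unit section generates, because \<open>s\<close> is \<open>s\<close> times one and
  restriction preserves one.\<close>

lemma locally_cyclic_structure_oset:
  assumes X: "is_monoidal_space X" and U: "openin (mtop X) U" "U \<noteq> {}"
  shows "locally_cyclic X U (structure_oset X)"
proof -
  have one: "monoid (sec X V)" if "openin (mtop X) V" for V
    using X that comm_monoid.axioms(1) unfolding is_monoidal_space_def by metis
  have "res X U W \<in> monoid_hom (sec X U) (sec X W)" if "openin (mtop X) W" "W \<subseteq> U" for W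
    using X U that unfolding is_monoidal_space_def by metis
  then have res: "res X U W \<one>\<^bsub>sec X U\<^esub> = \<one>\<^bsub>sec X W\<^esub>" if "openin (mtop X) W" "W \<subseteq> U" for W
    using that unfolding monoid_hom_def by blast
  have "\<exists>a\<in>carrier (sec X W). s = a \<otimes>\<^bsub>sec X W\<^esub> res X U W \<one>\<^bsub>sec X U\<^esub>"
    if "openin (mtop X) W" "W \<subseteq> U" "s \<in> carrier (sec X W)" for W s
    using that res monoid.r_one[OF one] by (metis (no_types))
  then show ?thesis
    unfolding locally_cyclic_def structure_oset_def
    using U monoid.one_closed[OF one[OF U(1)]]
    by (intro exI[of _ U] exI[of _ "\<one>\<^bsub>sec X U\<^esub>"]) simp
qed

text \<open>The preimage \<open>d\<close> of a generator is a generator: \<open>\<eta>\<close> is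
  equivariant and injective, so a relation between images already holds in \<open>F\<close>.\<close>

lemma locally_cyclic_nonempty_iso:
  assumes F: "oset_presheaf X F" and \<eta>: "nonempty_iso X U F G \<eta>" and G: "locally_cyclic X U G"
  shows "locally_cyclic X U F"
proof -
  obtain V e where V: "openin (mtop X) V" "V \<subseteq> U" "V \<noteq> {}" and e: "e \<in> osec G V"
    and gen: "\<And>W s. \<lbrakk>openin (mtop X) W; W \<subseteq> V; W \<noteq> {}; s \<in> osec G W\<rbrakk>
                \<Longrightarrow> \<exists>a\<in>carrier (sec X W). s = oact G W a (ores G V W e)"
    using G unfolding locally_cyclic_def by metis
  obtain d where d: "d \<in> osec F V" "e = \<eta> V d"
    using nonempty_isoD(1)[OF \<eta> V] e unfolding bij_betw_def by blast
  have "\<exists>a\<in>carrier (sec X W). s = oact F W a (ores F V W d)"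
    if W: "openin (mtop X) W" "W \<subseteq> V" "W \<noteq> {}" and s: "s \<in> osec F W" for W s
  proof -
    note WU = order_trans[OF W(2) V(2)]
    obtain a where a: "a \<in> carrier (sec X W)" "\<eta> W s = oact G W a (ores G V W e)"
      using gen[OF W nonempty_isoD(2)[OF \<eta> W(1) WU W(3) s]] by blast
    have r: "ores F V W d \<in> osec F W" using oset_presheafD(3)[OF F V(1) W(1,2) d(1)] .
    have "\<eta> W s = \<eta> W (oact F W a (ores F V W d))"
      using a(2) d nonempty_isoD(4)[OF \<eta> V W d(1)] nonempty_isoD(3)[OF \<eta> W(1) WU W(3) a(1) r]
      by simp
    moreover have "inj_on (\<eta> W) (osec F W)"
      using nonempty_isoD(1)[OF \<eta> W(1) WU W(3)] by (rule bij_betw_imp_inj_on)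
    ultimately have "s = oact F W a (ores F V W d)"
      using inj_onD[OF _ _ s oset_presheafD(2)[OF F W(1) a(1) r]] by metis
    then show ?thesis using a(1) by blast
  qed
  then show ?thesis unfolding locally_cyclic_def using V d(1) by blast
qed

lemma locally_cyclic_line_bundle:
  assumes X: "is_monoidal_space X" and irr: "irreducible_top (mtop X)"
    and F: "line_bundle X F" and U: "openin (mtop X) U" "U \<noteq> {}"
  shows "locally_cyclic X U F"
proof -
  obtain x where x: "x \<in> U" "x \<in> topspace (mtop X)" using U openin_subset by blast
  then obtain V \<eta> where V: "openin (mtop X) V" "x \<in> V"
    and \<eta>: "nonempty_iso X V F (structure_oset X) \<eta>" and sh: "oset_sheaf X F"
    using F unfolding line_bundle_iff[OF X irr] by blast
  have UV: "openin (mtop X) (U \<inter> V)" "U \<inter> V \<noteq> {}" using U V x by auto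
  have "nonempty_iso X (U \<inter> V) F (structure_oset X) \<eta>"
    using nonempty_iso_subset[OF \<eta>] by blast
  then have "locally_cyclic X (U \<inter> V) F"
    using locally_cyclic_nonempty_iso[OF oset_sheaf_imp_presheaf[OF sh]]
      locally_cyclic_structure_oset[OF X UV] by blast
  then show ?thesis by (rule locally_cyclic_mono) blast
qed

text \<open>The index \<open>j\<close> is that of the image of the generator \<open>e\<close> over
  \<open>V\<close>. A section over \<open>W\<close> is restricted to \<open>W \<inter> V\<close>,
  nonempty by irreducibility; there it is a multiple of \<open>e\<close>, and neither restriction
  nor the action changes the index of an image.\<close>

lemma component_constant:
  assumes irr: "irreducible_top (mtop X)" and L: "\<And>i. i < n \<Longrightarrow> oset_presheaf X (L i)"
    and \<theta>: "nonempty_iso X U (presheaf_coprod n L) (presheaf_coprod m L') \<theta>"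
    and i: "i < n" and gen: "locally_cyclic X U (L i)"
  shows "\<exists>j<m. \<forall>W s. openin (mtop X) W \<and> W \<subseteq> U \<and> W \<noteq> {} \<and> s \<in> osec (L i) W
           \<longrightarrow> fst (\<theta> W (i, s)) = j"
proof -
  obtain V e where V: "openin (mtop X) V" "V \<subseteq> U" "V \<noteq> {}" and e: "e \<in> osec (L i) V"
    and gen: "\<And>W s. \<lbrakk>openin (mtop X) W; W \<subseteq> V; W \<noteq> {}; s \<in> osec (L i) W\<rbrakk>
                \<Longrightarrow> \<exists>a\<in>carrier (sec X W). s = oact (L i) W a (ores (L i) V W e)"
    using gen unfolding locally_cyclic_def by metis
  note Li = oset_presheafD[OF L[OF i]]
  have mem: "(i, s) \<in> osec (presheaf_coprod n L) W" if "s \<in> osec (L i) W" for s W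
    using that i by (simp add: mem_osec_coprod)
  have res: "fst (\<theta> W (i, s)) = fst (\<theta> Z (i, ores (L i) W Z s))"
    if "openin (mtop X) W" "W \<subseteq> U" "openin (mtop X) Z" "Z \<subseteq> W" "Z \<noteq> {}" "s \<in> osec (L i) W"
    for W Z s
  proof -
    have "W \<noteq> {}" using that by blast
    then show ?thesis
      using nonempty_isoD(4)[OF \<theta> that(1,2) _ that(3,4,5) mem[OF that(6)]]
      by (simp add: ores_coprod)
  qed
  have "fst (\<theta> W (i, s)) = fst (\<theta> V (i, e))"
    if W: "openin (mtop X) W" "W \<subseteq> U" "W \<noteq> {}" and s: "s \<in> osec (L i) W" for W s
  proof -
    let ?Z = "W \<inter> V"
    have Z: "openin (mtop X) ?Z" "?Z \<noteq> {}" "?Z \<subseteq> U"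
      using W V irreducible_topD[OF irr] by auto
    have r: "ores (L i) V ?Z e \<in> osec (L i) ?Z" "ores (L i) W ?Z s \<in> osec (L i) ?Z"
      using Li(3) V W Z s e by simp_all
    obtain a where a: "a \<in> carrier (sec X ?Z)"
      "ores (L i) W ?Z s = oact (L i) ?Z a (ores (L i) V ?Z e)"
      using gen[OF Z(1) _ Z(2) r(2)] by blast
    have "fst (\<theta> W (i, s)) = fst (\<theta> ?Z (i, ores (L i) W ?Z s))" using res[OF W(1,2) Z(1) _ Z(2) s] by simp
    also have "\<dots> = fst (\<theta> ?Z (i, ores (L i) V ?Z e))"
      using nonempty_isoD(3)[OF \<theta> Z(1,3,2) a(1) mem[OF r(1)]] a(2) by (simp add: oact_coprod)
    also have "\<dots> = fst (\<theta> V (i, e))" using res[OF V(1,2) Z(1) _ Z(2) e] by simp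
    finally show ?thesis .
  qed
  moreover have "fst (\<theta> V (i, e)) < m"
    using nonempty_isoD(2)[OF \<theta> V mem[OF e]] by (simp add: mem_osec_coprod)
  ultimately show ?thesis by blast
qed

text \<open>Constancy of the index, applied to \<open>\<theta>\<close> and to its inverse, gives
  self-maps \<open>p\<close> and \<open>q\<close> of \<open>{..<n}\<close>. Since \<open>q\<close>
  undoes \<open>p\<close>, the map \<open>p\<close> is injective, hence bijective because the set is
  finite.\<close>

lemma component_permutation:
  assumes irr: "irreducible_top (mtop X)"
    and L: "\<And>i. i < n \<Longrightarrow> oset_presheaf X (L i)" and L': "\<And>i. i < n \<Longrightarrow> oset_presheaf X (L' i)"
    and \<theta>: "nonempty_iso X U (presheaf_coprod n L) (presheaf_coprod n L') \<theta>"
    and gen: "\<And>i. i < n \<Longrightarrow> locally_cyclic X U (L i)"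
    and gen': "\<And>i. i < n \<Longrightarrow> locally_cyclic X U (L' i)"
  shows "\<exists>\<pi>. \<pi> permutes {..<n} \<and>
    (\<forall>i W s. i < n \<and> openin (mtop X) W \<and> W \<subseteq> U \<and> W \<noteq> {} \<and> s \<in> osec (L i) W
       \<longrightarrow> fst (\<theta> W (i, s)) = \<pi> i)"
proof -
  let ?P = "presheaf_coprod n L" and ?P' = "presheaf_coprod n L'"
  define \<theta>' where "\<theta>' V = inv_into (osec ?P V) (\<theta> V)" for V
  have P: "oset_presheaf X ?P" using oset_presheaf_coprod L by metis
  have \<theta>': "nonempty_iso X U ?P' ?P \<theta>'"
    using nonempty_iso_sym[OF P \<theta>] unfolding \<theta>'_def .
  have "\<forall>i\<in>{..<n}. \<exists>j. j < n \<and> (\<forall>W s. openin (mtop X) W \<and> W \<subseteq> U \<and> W \<noteq> {} \<and>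
      s \<in> osec (L i) W \<longrightarrow> fst (\<theta> W (i, s)) = j)"
    using component_constant[OF irr L \<theta> _ gen] by simp
  then obtain p where p: "\<forall>i\<in>{..<n}. p i < n \<and> (\<forall>W s. openin (mtop X) W \<and> W \<subseteq> U \<and>
      W \<noteq> {} \<and> s \<in> osec (L i) W \<longrightarrow> fst (\<theta> W (i, s)) = p i)" by (rule bchoice[THEN exE])
  have "\<forall>i\<in>{..<n}. \<exists>j. j < n \<and> (\<forall>W s. openin (mtop X) W \<and> W \<subseteq> U \<and> W \<noteq> {} \<and>
      s \<in> osec (L' i) W \<longrightarrow> fst (\<theta>' W (i, s)) = j)"
    using component_constant[OF irr L' \<theta>' _ gen'] by simp
  then obtain q where q: "\<forall>i\<in>{..<n}. q i < n \<and> (\<forall>W s. openin (mtop X) W \<and> W \<subseteq> U \<and>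
      W \<noteq> {} \<and> s \<in> osec (L' i) W \<longrightarrow> fst (\<theta>' W (i, s)) = q i)" by (rule bchoice[THEN exE])
  have qp: "q (p i) = i" if i: "i < n" for i
  proof -
    \<comment> \<open>Without any section the index maps would be unconstrained; the generator
      supplies one at which both can be evaluated.\<close>
    obtain V e where V: "openin (mtop X) V" "V \<subseteq> U" "V \<noteq> {}" and e: "e \<in> osec (L i) V"
      using gen[OF i] unfolding locally_cyclic_def by metis
    have mem: "(i, e) \<in> osec ?P V" using i e by (simp add: mem_osec_coprod)
    have "\<theta> V (i, e) \<in> osec ?P' V" using nonempty_isoD(2)[OF \<theta> V mem] .
    moreover have "fst (\<theta> V (i, e)) = p i" using p i V e by simp
    ultimately obtain t where t: "\<theta> V (i, e) = (p i, t)" "p i < n" "t \<in> osec (L' (p i)) V"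
      by (cases "\<theta> V (i, e)") (simp add: mem_osec_coprod)
    have "\<theta>' V (p i, t) = (i, e)"
      using bij_betw_inv_into_left[OF nonempty_isoD(1)[OF \<theta> V] mem] t(1) unfolding \<theta>'_def by simp
    moreover have "fst (\<theta>' V (p i, t)) = q (p i)" using q t V by simp
    ultimately show ?thesis by simp
  qed
  \<comment> \<open>\<open>permutes\<close> demands a map on all natural numbers that is the
    identity outside \<open>{..<n}\<close>.\<close>
  define \<pi> where "\<pi> i = (if i < n then p i else i)" for i
  have "inj_on p {..<n}" using qp by (metis inj_on_inverseI lessThan_iff)
  then have "bij_betw p {..<n} {..<n}"
    using p endo_inj_surj[of "{..<n}" p] unfolding bij_betw_def by auto
  then have "bij_betw \<pi> {..<n} {..<n}"
    by (rule bij_betw_cong[THEN iffD1, rotated]) (simp add: \<pi>_def)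
  then have "\<pi> permutes {..<n}" by (rule bij_imp_permutes) (simp add: \<pi>_def)
  moreover have "\<forall>i W s. i < n \<and> openin (mtop X) W \<and> W \<subseteq> U \<and> W \<noteq> {} \<and> s \<in> osec (L i) W
       \<longrightarrow> fst (\<theta> W (i, s)) = \<pi> i" using p by (simp add: \<pi>_def)
  ultimately show ?thesis by blast
qed

text \<open>The point is surjectivity onto the component \<open>\<pi> i\<close>: a preimage under
  \<open>\<theta>\<close> exists in some component, and injectivity of \<open>\<pi>\<close>
  identifies that component as \<open>i\<close>.\<close>

lemma component_iso:
  assumes \<theta>: "nonempty_iso X U (presheaf_coprod n L) (presheaf_coprod n L') \<theta>"
    and \<pi>: "\<pi> permutes {..<n}"
    and comp: "\<And>i W s. \<lbrakk>i < n; openin (mtop X) W; W \<subseteq> U; W \<noteq> {}; s \<in> osec (L i) W\<rbrakk>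
                 \<Longrightarrow> fst (\<theta> W (i, s)) = \<pi> i"
    and i: "i < n"
  shows "nonempty_iso X U (L i) (L' (\<pi> i)) (\<lambda>W s. snd (\<theta> W (i, s)))"
proof -
  have mem: "(i, s) \<in> osec (presheaf_coprod n L) W" if "s \<in> osec (L i) W" for s W
    using that i by (simp add: mem_osec_coprod)
  show ?thesis
    unfolding nonempty_iso_def
  proof (intro allI impI conjI ballI, elim conjE, goal_cases)
    case (1 W)
    note bij = nonempty_isoD(1)[OF \<theta> 1]
    have "inj_on (\<lambda>s. snd (\<theta> W (i, s))) (osec (L i) W)"
    proof (rule inj_onI)
      fix s t assume st: "s \<in> osec (L i) W" "t \<in> osec (L i) W"
        and "snd (\<theta> W (i, s)) = snd (\<theta> W (i, t))"
      then have "\<theta> W (i, s) = \<theta> W (i, t)"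
        using comp[OF i 1 st(1)] comp[OF i 1 st(2)] by (simp add: prod_eq_iff)
      then show "s = t"
        using inj_onD[OF bij_betw_imp_inj_on[OF bij] _ mem[OF st(1)] mem[OF st(2)]] by simp
    qed
    moreover have "(\<lambda>s. snd (\<theta> W (i, s))) ` osec (L i) W = osec (L' (\<pi> i)) W"
    proof (intro subset_antisym subsetI)
      fix t assume "t \<in> (\<lambda>s. snd (\<theta> W (i, s))) ` osec (L i) W"
      then obtain s where s: "s \<in> osec (L i) W" "t = snd (\<theta> W (i, s))" by blast
      then show "t \<in> osec (L' (\<pi> i)) W"
        using nonempty_isoD(2)[OF \<theta> 1 mem[OF s(1)]] comp[OF i 1 s(1)]
        by (simp add: mem_osec_coprod)
    next
      fix t assume t: "t \<in> osec (L' (\<pi> i)) W"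
      have "\<pi> i < n" using permutes_in_image[OF \<pi>, of i] i by simp
      then have "(\<pi> i, t) \<in> osec (presheaf_coprod n L') W" using t by (simp add: mem_osec_coprod)
      then have "(\<pi> i, t) \<in> \<theta> W ` osec (presheaf_coprod n L) W"
        unfolding bij_betw_imp_surj_on[OF bij] .
      then obtain z where z: "z \<in> osec (presheaf_coprod n L) W" "\<theta> W z = (\<pi> i, t)"
        by (elim imageE) metis
      then have k: "fst z < n" "snd z \<in> osec (L (fst z)) W" by (simp_all add: mem_osec_coprod)
      have "\<pi> (fst z) = \<pi> i" using comp[OF k(1) 1 k(2)] z(2) by simp
      then have "fst z = i" using permutes_inj[OF \<pi>] by (simp add: inj_eq)
      then show "t \<in> (\<lambda>s. snd (\<theta> W (i, s))) ` osec (L i) W"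
        using k z(2) by (intro image_eqI[of _ _ "snd z"]) auto
    qed
    ultimately show ?case unfolding bij_betw_def ..
  next
    case (2 W a s)
    then show ?case
      using nonempty_isoD(3)[OF \<theta> _ _ _ _ mem, of W a s] comp[OF i, of W s]
      by (simp add: oact_coprod)
  next
    case (3 V W s)
    then show ?case
      using nonempty_isoD(4)[OF \<theta> _ _ _ _ _ _ mem, of V W s] comp[OF i, of V s]
      by (simp add: ores_coprod)
  qed
qed

section \<open>Splitting a bundle by an index function\<close>

lemma nonempty_iso_components:
  assumes F: "oset_presheaf X F"
    and c: "\<And>V s. \<lbrakk>openin (mtop X) V; V \<noteq> {}; s \<in> osec F V\<rbrakk> \<Longrightarrow> c V s < n"
    and c_act: "\<And>V a s. \<lbrakk>openin (mtop X) V; V \<noteq> {}; a \<in> carrier (sec X V); s \<in> osec F V\<rbrakk>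
            \<Longrightarrow> c V (oact F V a s) = c V s"
    and c_res: "\<And>V W s. \<lbrakk>openin (mtop X) V; openin (mtop X) W; W \<subseteq> V; W \<noteq> {}; s \<in> osec F V\<rbrakk>
            \<Longrightarrow> c W (ores F V W s) = c V s"
  shows "nonempty_iso X U F
           (presheaf_coprod n (\<lambda>i. F\<lparr>osec := \<lambda>V. {s \<in> osec F V. V \<noteq> {} \<longrightarrow> c V s = i}\<rparr>))
           (\<lambda>V s. (c V s, s))"
  unfolding nonempty_iso_def
proof (intro allI impI conjI ballI, elim conjE, goal_cases)
  case (1 V)
  have "c V s < n" if "s \<in> osec F V" for s using 1 c that by simp
  then show ?case using 1
    by (intro bij_betw_byWitness[of _ snd]) (auto simp: mem_osec_coprod)
next
  case (2 V a s) then show ?case using c_act by (simp add: oact_coprod)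
next
  case (3 V W s) then show ?case using c_res by (simp add: ores_coprod)
qed

text \<open>A glued section takes its index from any nonempty member of the covering. Over the empty
  set the index is left unconstrained, so that every component keeps the one section there.
  Restriction and action are those of \<open>F\<close>, hence the component has the same type of
  sections as \<open>F\<close>.\<close>

lemma component_oset_sheaf:
  assumes F: "oset_sheaf X F"
    and c_act: "\<And>V a s. \<lbrakk>openin (mtop X) V; V \<noteq> {}; a \<in> carrier (sec X V); s \<in> osec F V\<rbrakk>
            \<Longrightarrow> c V (oact F V a s) = c V s"
    and c_res: "\<And>V W s. \<lbrakk>openin (mtop X) V; openin (mtop X) W; W \<subseteq> V; W \<noteq> {}; s \<in> osec F V\<rbrakk>
            \<Longrightarrow> c W (ores F V W s) = c V s"
  shows "oset_sheaf X (F\<lparr>osec := \<lambda>V. {s \<in> osec F V. V \<noteq> {} \<longrightarrow> c V s = i}\<rparr>)"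
proof -
  let ?L = "\<lambda>V. {s \<in> osec F V. V \<noteq> {} \<longrightarrow> c V s = i}"
  interpret set_sheaf "mtop X" "osec F" "ores F" by (rule oset_sheaf_set_sheaf[OF F])
  have "set_sheaf (mtop X) ?L (ores F)"
  proof (unfold_locales, goal_cases)
    case (1 U V s) then show ?case using restr_closed[of U V s] c_res[of U V s] by auto
  next
    case (2 U s) then show ?case using restr_id by simp
  next
    case (3 U V W s) then show ?case using restr_restr[of U V W s] by simp
  next
    case (4 \<U> \<sigma>)
    have op: "openin (mtop X) (\<Union>\<U>)" using 4(1) by (rule openin_Union)
    have "\<exists>!s. s \<in> osec F (\<Union>\<U>) \<and> (\<forall>U\<in>\<U>. ores F (\<Union>\<U>) U s = \<sigma> U)"
      by (rule glue) (use 4 in simp_all)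
    moreover have "c (\<Union>\<U>) s = i"
      if s: "s \<in> osec F (\<Union>\<U>) \<and> (\<forall>U\<in>\<U>. ores F (\<Union>\<U>) U s = \<sigma> U)" and ne: "\<Union>\<U> \<noteq> {}" for s
    proof -
      obtain U where U: "U \<in> \<U>" "U \<noteq> {}" using ne by auto
      have "c (\<Union>\<U>) s = c U (\<sigma> U)"
        using c_res[OF op 4(1)[OF U(1)] _ U(2), of s] s U(1) Union_upper[OF U(1)] by simp
      then show ?thesis using 4(2)[OF U(1)] U(2) by simp
    qed
    ultimately show ?case by (simp cong: conj_cong) metis
  qed
  moreover note F[unfolded oset_sheaf_def]
  ultimately show ?thesis
    unfolding oset_sheaf_def using c_act by (simp add: set_sheaf_def)
qed

text \<open>The index comes from one trivialization \<open>\<eta>\<^sub>0\<close>, so the components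
  are visibly free of rank one only inside \<open>U\<^sub>0\<close>. Another trivialization
  \<open>\<eta>\<close> may number its summands differently; as the components are cyclic, it
  differs from the chosen numbering by a permutation and still trivializes each of them.\<close>

lemma exists_decomposition:
  fixes F :: "('p, 's, 't) oset"
  assumes X: "is_monoidal_space X" and irr: "irreducible_top (mtop X)" and F: "vector_bundle X n F"
  shows "\<exists>L :: nat \<Rightarrow> ('p, 's, 't) oset. (\<forall>i<n. line_bundle X (L i)) \<and>
             (\<exists>\<eta>. nonempty_iso X (topspace (mtop X)) F (presheaf_coprod n L) \<eta>)"
proof (cases "topspace (mtop X) = {}")
  \<comment> \<open>There is no \<open>U\<^sub>0\<close> to read an index from. Local triviality is
    vacuous on the empty space, so \<open>F\<close> itself can serve as every summand.\<close>
  case True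
  have lb: "line_bundle X F"
    using F True unfolding vector_bundle_def by simp
  have iso: "nonempty_iso X (topspace (mtop X)) F (presheaf_coprod n (\<lambda>_. F)) \<eta>" for \<eta>
    using True unfolding nonempty_iso_def by simp
  show ?thesis by (rule exI[of _ "\<lambda>_. F"]) (simp add: lb[simplified] iso)
next
  case False
  let ?P = "presheaf_coprod n (\<lambda>_. structure_oset X)"
  have sh: "oset_sheaf X F"
    and triv: "\<And>x. x \<in> topspace (mtop X) \<Longrightarrow> \<exists>U. openin (mtop X) U \<and> x \<in> U \<and>
      (\<exists>\<eta>. nonempty_iso X U F ?P \<eta>)"
    using F unfolding vector_bundle_iff[OF X irr] by simp_all
  note Fp = oset_sheaf_imp_presheaf[OF sh]
  note O = oset_sheaf_imp_presheaf[OF structure_oset_sheaf[OF X]]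
  obtain x0 where "x0 \<in> topspace (mtop X)" using False by blast
  then obtain U\<^sub>0 \<eta>\<^sub>0 where U\<^sub>0: "openin (mtop X) U\<^sub>0" "x0 \<in> U\<^sub>0"
    and \<eta>\<^sub>0: "nonempty_iso X U\<^sub>0 F ?P \<eta>\<^sub>0"
    using triv[of x0] by metis
  have meet: "openin (mtop X) (V \<inter> U\<^sub>0)" "V \<inter> U\<^sub>0 \<noteq> {}" if "openin (mtop X) V" "V \<noteq> {}" for V
    using irreducible_topD[OF irr that(1) U\<^sub>0(1) that(2)] U\<^sub>0 that by auto
  define c where "c V s = fst (\<eta>\<^sub>0 (V \<inter> U\<^sub>0) (ores F V (V \<inter> U\<^sub>0) s))" for V s
  have r: "ores F V (V \<inter> U\<^sub>0) s \<in> osec F (V \<inter> U\<^sub>0)"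
    if "openin (mtop X) V" "V \<noteq> {}" "s \<in> osec F V" for V s
    using oset_presheafD(3)[OF Fp that(1) meet(1)[OF that(1,2)] _ that(3)] by simp
  have c_less: "c V s < n" if V: "openin (mtop X) V" "V \<noteq> {}" "s \<in> osec F V" for V s
    using nonempty_isoD(2)[OF \<eta>\<^sub>0 meet(1)[OF V(1,2)] _ meet(2)[OF V(1,2)] r[OF V]]
    unfolding c_def by (simp add: mem_osec_coprod)
  have c_act: "c V (oact F V a s) = c V s"
    if V: "openin (mtop X) V" "V \<noteq> {}" and a: "a \<in> carrier (sec X V)" and s: "s \<in> osec F V" for V a s
  proof -
    note m = meet[OF V]
    have "set_presheaf (mtop X) (\<lambda>U. carrier (sec X U)) (res X)"
      using O unfolding oset_presheaf_def structure_oset_def by simp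
    then have "res X V (V \<inter> U\<^sub>0) a \<in> carrier (sec X (V \<inter> U\<^sub>0))"
      by (rule set_presheaf.restr_closed) (use V m a in auto)
    then show ?thesis
      using oset_presheafD(4)[OF Fp V(1) m(1) _ a s] nonempty_isoD(3)[OF \<eta>\<^sub>0 m(1) _ m(2) _ r[OF V s]]
      unfolding c_def by (simp add: oact_coprod)
  qed
  have c_res: "c W (ores F V W s) = c V s"
    if V: "openin (mtop X) V" and W: "openin (mtop X) W" "W \<subseteq> V" "W \<noteq> {}" and s: "s \<in> osec F V"
    for V W s
  proof -
    have ne: "V \<noteq> {}" using W by blast
    have sub: "W \<inter> U\<^sub>0 \<subseteq> V \<inter> U\<^sub>0" using W by blast
    note mV = meet[OF V ne] and mW = meet[OF W(1,3)]
    have "ores F W (W \<inter> U\<^sub>0) (ores F V W s) = ores F V (W \<inter> U\<^sub>0) s"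
      using oset_presheafD(5)[OF Fp V W(1) mW(1) _ W(2) s] by simp
    also have "\<dots> = ores F (V \<inter> U\<^sub>0) (W \<inter> U\<^sub>0) (ores F V (V \<inter> U\<^sub>0) s)"
      using oset_presheafD(5)[OF Fp V mV(1) mW(1) sub _ s] by simp
    finally show ?thesis
      using nonempty_isoD(4)[OF \<eta>\<^sub>0 mV(1) _ mV(2) mW(1) sub mW(2) r[OF V ne s]]
      unfolding c_def by (simp add: ores_coprod)
  qed
  define L where "L i = F\<lparr>osec := \<lambda>V. {s \<in> osec F V. V \<noteq> {} \<longrightarrow> c V s = i}\<rparr>" for i
  have Lsh: "oset_sheaf X (L i)" for i
    unfolding L_def by (rule component_oset_sheaf[OF sh]) (use c_act c_res in auto)
  note Lp = oset_sheaf_imp_presheaf[OF Lsh]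
  have PL: "oset_presheaf X (presheaf_coprod n L)" by (rule oset_presheaf_coprod) (rule Lp)
  have split: "nonempty_iso X U F (presheaf_coprod n L) (\<lambda>V s. (c V s, s))" for U
    unfolding L_def by (rule nonempty_iso_components[OF Fp]) (use c_less c_act c_res in auto)
  \<comment> \<open>The inverse of the splitting is given explicitly by \<open>snd\<close>, so that
    its composite with a trivialization has a simple form.\<close>
  have "bij_betw snd (osec (presheaf_coprod n L) V) (osec F V)"
    if "openin (mtop X) V" "V \<noteq> {}" for V
    by (rule bij_betw_byWitness[of _ "\<lambda>s. (c V s, s)"])
      (use that c_less[OF that] in \<open>auto simp: mem_osec_coprod L_def\<close>)
  then have unsplit: "nonempty_iso X U (presheaf_coprod n L) F (\<lambda>_. snd)" for U
    unfolding nonempty_iso_def by (simp add: ores_coprod oact_coprod L_def)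
  have cyc0: "locally_cyclic X V (L i)" if V: "openin (mtop X) V" "V \<noteq> {}" and i: "i < n" for V i
  proof -
    note m = meet[OF V]
    have \<theta>: "nonempty_iso X (V \<inter> U\<^sub>0) (presheaf_coprod n L) ?P (\<lambda>V. \<eta>\<^sub>0 V \<circ> snd)"
      using nonempty_iso_trans[OF unsplit nonempty_iso_subset[OF \<eta>\<^sub>0]] by simp
    \<comment> \<open>Inside \<open>U\<^sub>0\<close> the index \<open>c\<close> is by construction
      the one given by \<open>\<eta>\<^sub>0\<close>, so the permutation is the identity and
      \<open>L i\<close> becomes the structure sheaf there.\<close>
    have "nonempty_iso X (V \<inter> U\<^sub>0) (L i) (structure_oset X) (\<lambda>W s. snd ((\<eta>\<^sub>0 W \<circ> snd) (i, s)))"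
    proof (rule component_iso[OF \<theta> permutes_id _ i])
      fix j W s assume W: "openin (mtop X) W" "W \<subseteq> V \<inter> U\<^sub>0" "W \<noteq> {}" and s: "s \<in> osec (L j) W"
      have "W \<inter> U\<^sub>0 = W" using W by blast
      moreover have "s \<in> osec F W" "c W s = j" using s W by (simp_all add: L_def)
      moreover have "ores F W W s = s"
        using set_presheaf.restr_id[OF oset_presheafD(1)[OF Fp] W(1)] \<open>s \<in> osec F W\<close> by simp
      ultimately show "fst ((\<eta>\<^sub>0 W \<circ> snd) (j, s)) = id j" unfolding c_def by simp
    qed
    then have "locally_cyclic X (V \<inter> U\<^sub>0) (L i)"
      by (rule locally_cyclic_nonempty_iso[OF Lp _ locally_cyclic_structure_oset[OF X m]])
    then show ?thesis by (rule locally_cyclic_mono) blast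
  qed
  have "line_bundle X (L i)" if i: "i < n" for i
    unfolding line_bundle_iff[OF X irr]
  proof (intro conjI ballI)
    fix x assume "x \<in> topspace (mtop X)"
    then obtain U \<eta> where U: "openin (mtop X) U" "x \<in> U" and \<eta>: "nonempty_iso X U F ?P \<eta>"
      using triv[of x] by metis
    have ne: "U \<noteq> {}" using U by blast
    \<comment> \<open>Undoing the splitting and then applying \<open>\<eta>\<close> compares the
      coproduct of the components with the free one over \<open>U\<close>. Both have cyclic
      summands, so the permutation lemma applies.\<close>
    note \<theta> = nonempty_iso_trans[OF unsplit \<eta>]
    obtain \<pi> where \<pi>: "\<pi> permutes {..<n}"
      and comp: "\<forall>i W s. i < n \<and> openin (mtop X) W \<and> W \<subseteq> U \<and> W \<noteq> {} \<and> s \<in> osec (L i) W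
         \<longrightarrow> fst ((\<eta> W \<circ> snd) (i, s)) = \<pi> i"
      using component_permutation[OF irr Lp O \<theta> cyc0[OF U(1) ne]
          locally_cyclic_structure_oset[OF X U(1) ne]] by metis
    have "nonempty_iso X U (L i) (structure_oset X) (\<lambda>W s. snd ((\<eta> W \<circ> snd) (i, s)))"
      by (rule component_iso[OF \<theta> \<pi> _ i]) (use comp in simp)
    then show "\<exists>U. openin (mtop X) U \<and> x \<in> U \<and> (\<exists>\<eta>. nonempty_iso X U (L i) (structure_oset X) \<eta>)"
      using U by blast
  qed (rule Lsh)
  then show ?thesis using split by blast
qed

text \<open>Passing through \<open>F\<close> turns two decompositions into one isomorphism of
  presheaf coproducts over the whole space. Line bundles are locally cyclic, so it permutes the
  summands, and its restrictions to them are global isomorphisms.\<close>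

lemma decomposition_unique:
  assumes X: "is_monoidal_space X" and irr: "irreducible_top (mtop X)" and F: "oset_presheaf X F"
    and L: "\<And>i. i < n \<Longrightarrow> line_bundle X (L i)" and L': "\<And>i. i < n \<Longrightarrow> line_bundle X (L' i)"
    and \<eta>: "nonempty_iso X (topspace (mtop X)) F (presheaf_coprod n L) \<eta>"
    and \<eta>': "nonempty_iso X (topspace (mtop X)) F (presheaf_coprod n L') \<eta>'"
  shows "\<exists>\<pi>. \<pi> permutes {..<n} \<and> (\<forall>i<n. oset_isomorphic X (L i) (L' (\<pi> i)))"
proof -
  let ?T = "topspace (mtop X)"
  have sh: "oset_sheaf X (L i)" "oset_sheaf X (L' i)" if "i < n" for i
    using L[OF that] L'[OF that] unfolding vector_bundle_def by simp_all
  have isoI: "oset_isomorphic X (L i) (L' j)"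
    if "i < n" "j < n" "nonempty_iso X ?T (L i) (L' j) \<theta>" for i j \<theta>
    using oset_isomorphicI[OF openin_topspace that(3) terminal_at_empty_sheaf[OF sh(1)[OF that(1)]]
        terminal_at_empty_sheaf[OF sh(2)[OF that(2)]]]
    unfolding open_subspace_topspace .
  show ?thesis
  proof (cases "?T = {}")
    \<comment> \<open>No generator over a nonempty open set exists here, but on the empty space any
      two line bundles are isomorphic and the identity permutation works.\<close>
    case True
    then have "nonempty_iso X ?T (L i) (L' i) \<theta>" for i \<theta> unfolding nonempty_iso_def by simp
    then show ?thesis using isoI by (intro exI[of _ id]) (simp add: permutes_id)
  next
    case False
    note \<theta> = nonempty_iso_trans[OF nonempty_iso_sym[OF F \<eta>] \<eta>']
    let ?\<theta> = "\<lambda>V. \<eta>' V \<circ> inv_into (osec F V) (\<eta> V)"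
    obtain \<pi> where \<pi>: "\<pi> permutes {..<n}"
      and comp: "\<forall>i W s. i < n \<and> openin (mtop X) W \<and> W \<subseteq> ?T \<and> W \<noteq> {} \<and> s \<in> osec (L i) W
         \<longrightarrow> fst (?\<theta> W (i, s)) = \<pi> i"
      using component_permutation[OF irr oset_sheaf_imp_presheaf[OF sh(1)]
          oset_sheaf_imp_presheaf[OF sh(2)] \<theta>
          locally_cyclic_line_bundle[OF X irr L openin_topspace False]
          locally_cyclic_line_bundle[OF X irr L' openin_topspace False]] by metis
    have "oset_isomorphic X (L i) (L' (\<pi> i))" if i: "i < n" for i
    proof (rule isoI[OF i])
      show "\<pi> i < n" using permutes_in_image[OF \<pi>, of i] i by simp
      show "nonempty_iso X ?T (L i) (L' (\<pi> i)) (\<lambda>W s. snd (?\<theta> W (i, s)))"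
        by (rule component_iso[OF \<theta> \<pi> _ i]) (use comp in simp)
    qed
    then show ?thesis using \<pi> by blast
  qed
qed

theorem theorem3p3:
  fixes X :: "('p, 's) monoidal_space"
    and F :: "('p, 's, 't) oset"
    and n :: nat
  assumes "mscheme X" and "connected_space (mtop X)" and "separated X"
    and "n \<ge> 1" and "vector_bundle X n F"
  shows "(\<exists>L :: nat \<Rightarrow> ('p, 's, 't) oset.
            (\<forall>i<n. line_bundle X (L i)) \<and> oset_isomorphic X F (oset_coprod X n L)) \<and>
         (\<forall>(L :: nat \<Rightarrow> ('p, 's, 'u) oset) (L' :: nat \<Rightarrow> ('p, 's, 'v) oset).
            (\<forall>i<n. line_bundle X (L i)) \<and> oset_isomorphic X F (oset_coprod X n L) \<and>
            (\<forall>i<n. line_bundle X (L' i)) \<and> oset_isomorphic X F (oset_coprod X n L')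
            \<longrightarrow> (\<exists>\<pi>. \<pi> permutes {..<n} \<and> (\<forall>i<n. oset_isomorphic X (L i) (L' (\<pi> i)))))"
proof -
  have X: "is_monoidal_space X" using assms(1) unfolding mscheme_def by simp
  have irr: "irreducible_top (mtop X)"
    using assms(1,2) by (rule irreducible_top_connected_mscheme)
  have F: "oset_sheaf X F" using assms(5) unfolding vector_bundle_def by simp
  let ?T = "topspace (mtop X)"
  note iff = nonempty_iso_coprod_iff[OF X irr openin_topspace F, unfolded open_subspace_topspace]
  \<comment> \<open>The section type stays polymorphic, because this fact is applied to families of
    line bundles over three different types.\<close>
  have sheaf: "oset_sheaf X G" if "line_bundle X G" for G :: "('p, 's, 'w) oset"
    using that unfolding vector_bundle_def by simp
  show ?thesis
  proof (intro conjI allI impI, goal_cases)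
    case 1
    obtain L :: "nat \<Rightarrow> ('p, 's, 't) oset" where "(\<forall>i<n. line_bundle X (L i)) \<and>
        (\<exists>\<eta>. nonempty_iso X ?T F (presheaf_coprod n L) \<eta>)"
      using exists_decomposition[OF X irr assms(5)] ..
    then have L: "\<forall>i<n. line_bundle X (L i)"
      and \<eta>: "\<exists>\<eta>. nonempty_iso X ?T F (presheaf_coprod n L) \<eta>" by simp_all
    have "oset_isomorphic X F (oset_coprod X n L)"
      by (rule iff[THEN iffD2, OF sheaf \<eta>]) (use L in simp)
    then show ?case using L by (intro exI[of _ L] conjI)
  next
    case (2 L L')
    then have L: "\<forall>i<n. line_bundle X (L i)" "\<forall>i<n. line_bundle X (L' i)" by simp_all
    have "\<exists>\<eta>. nonempty_iso X ?T F (presheaf_coprod n L) \<eta>"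
      by (rule iff[THEN iffD1, OF sheaf]) (use 2 in simp_all)
    then obtain \<eta> where \<eta>: "nonempty_iso X ?T F (presheaf_coprod n L) \<eta>" ..
    have "\<exists>\<eta>. nonempty_iso X ?T F (presheaf_coprod n L') \<eta>"
      by (rule iff[THEN iffD1, OF sheaf]) (use 2 in simp_all)
    then obtain \<eta>' where \<eta>': "nonempty_iso X ?T F (presheaf_coprod n L') \<eta>'" ..
    show ?case
      by (rule decomposition_unique[OF X irr oset_sheaf_imp_presheaf[OF F] _ _ \<eta> \<eta>'])
        (use L in simp_all)
  qed
qed

end
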